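(* For every $\epsilon,\delta>0$ there exist $N$ and a constant $c_\Delta$ (depending on $\epsilon,\delta,|\mathcal{X}|,|\mathcal{Y}|$) such that for every $n\ge N$ there is a rate-adaptive system with feedback and common randomness over $n$ channel uses such that, for every sequence of channels $W_1,\dots,W_n$ from $\mathcal{X}$ to $\mathcal{Y}$: (1) the probability of error is at most $\epsilon$; (2) with probability at least $1-\delta$ the rate satisfies $R\ge C(\overline W)-\Delta_C$, where $\overline W=\frac1n\sum_{i=1}^nW_i$ and $\Delta_C=c_\Delta\left(\frac{\ln^2 n}{n}\right)^{1/4}$.
   Context: $\mathcal{X},\mathcal{Y}$ are finite sets. A channel is a conditional pmf $W(y|x)$; $I(Q,W)$ is the mutual information in bits of the joint law $Q(x)W(y|x)$ and $C(W)=\max_Q I(Q,W)$. Channel model: $\Pr(\mathbf Y|\mathbf X)=\prod_{i=1}^n W_i(Y_i|X_i)$ (the output at time $i$ depends only on $X_i$ through $W_i$). A rate-adaptive system with feedback and common randomness over $n$ channel uses consists of: a random variable $S$ (common randomness) known to encoder and decoder, independent of the message and the channel; a message given by an infinite sequence of i.i.d. uniform bits $b_1,b_2,\dots$; encoding functions $X_i=f_i(b_1^\infty,Y_1^{i-1},S)$ (perfect instantaneous feedback); and a decoder that after $n$ uses outputs a rate $R=g(Y_1^n,S)\ge0$ and an estimate of the first $\lceil nR\rceil$ message bits; an error occurs if this estimate differs from $b_1^{\lceil nR\rceil}$. *)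

theory Defs
  imports "HOL-Probability.Probability"
begin

definition mutual_info :: "'x::finite pmf \<Rightarrow> ('x \<Rightarrow> 'y::finite pmf) \<Rightarrow> real" where
  "mutual_info Q W =
     (\<Sum>x\<in>UNIV. \<Sum>y\<in>UNIV.
        (if pmf Q x * pmf (W x) y = 0 then 0
         else pmf Q x * pmf (W x) y * log 2 (pmf (W x) y / pmf (bind_pmf Q W) y)))"

definition capacity :: "('x::finite \<Rightarrow> 'y::finite pmf) \<Rightarrow> real" where
  "capacity W = (SUP Q. mutual_info Q W)"

definition avg_channel :: "nat \<Rightarrow> (nat \<Rightarrow> 'x \<Rightarrow> 'y pmf) \<Rightarrow> 'x \<Rightarrow> 'y pmf" where
  "avg_channel n W = (\<lambda>x. bind_pmf (pmf_of_set {..<n}) (\<lambda>i. W i x))"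

definition bits_M :: "(nat \<Rightarrow> bool) measure" where
  "bits_M = (\<Pi>\<^sub>M i\<in>UNIV. measure_pmf (bernoulli_pmf (1/2)))"

text \<open>Conditional probability of output sequence ys (length n) given message b and common
  randomness s, with encoder f: X_i = f i b (Y_0..Y_{i-1}) s.\<close>
definition out_prob :: "nat \<Rightarrow> (nat \<Rightarrow> 'x \<Rightarrow> 'y pmf) \<Rightarrow>
    (nat \<Rightarrow> (nat \<Rightarrow> bool) \<Rightarrow> 'y list \<Rightarrow> real \<Rightarrow> 'x) \<Rightarrow>
    (nat \<Rightarrow> bool) \<Rightarrow> real \<Rightarrow> 'y list \<Rightarrow> real" where
  "out_prob n W f b s ys = (\<Prod>i<n. pmf (W i (f i b (take i ys) s)) (ys ! i))"

definition sys_prob :: "nat \<Rightarrow> (nat \<Rightarrow> 'x \<Rightarrow> 'y::finite pmf) \<Rightarrow> real measure \<Rightarrow>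
    (nat \<Rightarrow> (nat \<Rightarrow> bool) \<Rightarrow> 'y list \<Rightarrow> real \<Rightarrow> 'x) \<Rightarrow>
    ((nat \<Rightarrow> bool) \<Rightarrow> real \<Rightarrow> 'y list \<Rightarrow> bool) \<Rightarrow> real" where
  "sys_prob n W MSr f E =
     (\<integral>bs. (\<Sum>ys\<in>{ys. length ys = n}.
              out_prob n W f (fst bs) (snd bs) ys * indicator {ys. E (fst bs) (snd bs) ys} ys)
      \<partial>(bits_M \<Otimes>\<^sub>M MSr))"

text \<open>A rate-adaptive system with feedback and common randomness over n uses:
  common randomness S with (arbitrary) distribution MSr, encoders f, rate function g,
  bit-estimate dec; all measurable.\<close>
definition ra_system :: "nat \<Rightarrow> real measure \<Rightarrow>
    (nat \<Rightarrow> (nat \<Rightarrow> bool) \<Rightarrow> 'y list \<Rightarrow> real \<Rightarrow> 'x) \<Rightarrow>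
    ('y list \<Rightarrow> real \<Rightarrow> real) \<Rightarrow> ('y list \<Rightarrow> real \<Rightarrow> nat \<Rightarrow> bool) \<Rightarrow> bool" where
  "ra_system n MSr f g dec \<longleftrightarrow>
     prob_space MSr \<and>
     (\<forall>i<n. \<forall>ys. (\<lambda>bs. f i (fst bs) ys (snd bs)) \<in> (bits_M \<Otimes>\<^sub>M MSr) \<rightarrow>\<^sub>M count_space UNIV) \<and>
     (\<forall>ys. g ys \<in> borel_measurable MSr) \<and>
     (\<forall>ys j. (\<lambda>s. dec ys s j) \<in> MSr \<rightarrow>\<^sub>M count_space UNIV) \<and>
     (\<forall>ys. \<forall>s\<in>space MSr. g ys s \<ge> 0)"

definition decoding_error :: "nat \<Rightarrow> ('y list \<Rightarrow> real \<Rightarrow> real) \<Rightarrow> ('y list \<Rightarrow> real \<Rightarrow> nat \<Rightarrow> bool)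
    \<Rightarrow> (nat \<Rightarrow> bool) \<Rightarrow> real \<Rightarrow> 'y list \<Rightarrow> bool" where
  "decoding_error n g dec b s ys \<longleftrightarrow> (\<exists>j < nat \<lceil>real n * g ys s\<rceil>. dec ys s j \<noteq> b j)"

end

theory Submission
  imports Defs "HOL-Real_Asymp.Real_Asymp"
begin

text \<open>
  At each time the scheme chooses, from past pilots only, a prior \<open>Q\<close> on the inputs
  and, for each output \<open>y\<close>, a distribution \<open>a(\<cdot>|y)\<close> on the inputs.  Codewords are drawn
  independently from \<open>Q\<close>, and a candidate message is scored by the product of the factors
  \<open>a(x|y) / Q(x)\<close>.  Whatever \<open>Q\<close>, \<open>a\<close> and the channel are, the score of a wrong message is a
  nonnegative martingale, so declaring a block of \<open>K\<close> bits once a score reaches \<open>2\<^sup>K M\<close>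
  errs with probability of order \<open>1/M\<close> per block.

  The expected logarithmic score of the true message grows by
  \<open>F(Q, a; W) = - \<Sum> W(y|x) Q(x) ln (Q(x) / a(x|y))\<close>, which is jointly concave in \<open>(Q, a)\<close>, linear
  in \<open>W\<close>, and whose maximum is the capacity of \<open>W\<close>.  By linearity, a learner with small regret against
  every fixed \<open>(Q, a)\<close> attains the capacity of the averaged channel.  The learner is exponentiated
  gradient ascent with smoothing, fed by importance-weighted pilots sent at random times.  An
  exponential supermartingale combining the learner's potential with the accumulated score gives the
  bound with high probability.  With pilot probability and smoothing \<open>n\<^sup>-\<^sup>1\<^sup>/\<^sup>4\<close> and learning rate
  \<open>n\<^sup>-\<^sup>3\<^sup>/\<^sup>4\<close> the loss per channel use is of order \<open>n\<^sup>-\<^sup>1\<^sup>/\<^sup>4\<close>, so \<open>c\<^sub>\<Delta> = 1\<close>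
  suffices for large \<open>n\<close>.
\<close>

section \<open>Elementary inequalities\<close>

lemma exp_le_quadratic:
  fixes z :: real
  assumes "\<bar>z\<bar> \<le> 1"
  shows "exp z \<le> 1 + z + z\<^sup>2"
proof (cases "0 \<le> z")
  case True
  then show ?thesis using assms exp_bound[of z] by simp
next
  case False
  define t where "t = - z"
  have t: "0 < t" "t \<le> 1" using False assms by (auto simp: t_def)
  have "exp z = inverse (exp t)" by (simp add: t_def exp_minus)
  also have "\<dots> \<le> inverse (1 + t)"
    using t exp_ge_add_one_self[of t] by (intro le_imp_inverse_le) auto
  also have "\<dots> \<le> 1 - t + t\<^sup>2"
  proof -
    have "1 \<le> (1 - t + t\<^sup>2) * (1 + t)"
      using t by (simp add: algebra_simps power2_eq_square)
    then show ?thesis using t by (simp add: field_simps)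
  qed
  finally show ?thesis by (simp add: t_def)
qed

lemma neg_xlnx_bounds:
  fixes u :: real
  assumes "0 \<le> u" "u \<le> 1"
  shows "0 \<le> - u * ln u" and "- u * ln u \<le> 1"
proof -
  show "0 \<le> - u * ln u"
    using assms by (cases "u = 0") (auto simp: mult_nonneg_nonpos)
  show "- u * ln u \<le> 1"
  proof (cases "u = 0")
    case False
    then have u: "0 < u" using assms by simp
    have "ln (1/u) \<le> 1/u - 1" using u by (intro ln_le_minus_one) simp
    then have "u * ln (1/u) \<le> u * (1/u - 1)" using u by (intro mult_left_mono) auto
    also have "u * ln (1/u) = - u * ln u" using u by (simp add: ln_div)
    also have "u * (1/u - 1) = 1 - u" using u by (simp add: right_diff_distrib)
    finally show ?thesis using u by simp
  qed simp
qed

text \<open>The function \<open>- u ln (u / v)\<close> is concave and homogeneous, so it lies below each of its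
  tangent planes, and these pass through the origin.\<close>

lemma log_ratio_tangent:
  fixes u v r :: real
  assumes "0 \<le> u" "0 < v" "0 < r"
  shows "- u * ln (u / v) \<le> - u * (ln r + 1) + v * r"
proof (cases "u = 0")
  case False
  then have u: "0 < u" using assms by simp
  have "ln (r * v / u) \<le> r * v / u - 1" using u assms by (intro ln_le_minus_one) simp
  then have "u * ln (r * v / u) \<le> u * (r * v / u - 1)" using u by (intro mult_left_mono) auto
  also have "u * ln (r * v / u) = u * ln r - u * ln (u / v)"
    using u assms by (simp add: ln_div ln_mult right_diff_distrib distrib_left)
  also have "u * (r * v / u - 1) = v * r - u" using u by (simp add: right_diff_distrib)
  finally show ?thesis by (simp add: distrib_left)
qed (use assms in simp)

text \<open>Apply \<open>ln z \<le> z - 1\<close> to \<open>sqrt x\<close> and square. This keeps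
  squared logarithmic gradients linear, not quadratic, in the inverse amount of smoothing.\<close>

lemma square_ln_add_one_le:
  fixes x :: real
  assumes "1 \<le> x"
  shows "(ln x + 1)\<^sup>2 \<le> 4 * x"
proof -
  have "ln (sqrt x) \<le> sqrt x - 1" using assms by (intro ln_le_minus_one) simp
  then have "ln x + 1 \<le> 2 * sqrt x" using assms by (simp add: ln_sqrt)
  then have "(ln x + 1)\<^sup>2 \<le> (2 * sqrt x)\<^sup>2"
    using assms by (intro power_mono) auto
  then show ?thesis using assms by (simp add: power_mult_distrib)
qed

section \<open>The online learner\<close>

text \<open>
  \<open>lam\<close> is the pilot probability, \<open>bet\<close> the amount of smoothing, \<open>eta\<close> the learning rate,
  \<open>thr\<close> the decoding threshold and \<open>K\<close> the number of bits per block.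
\<close>

locale scheme =
  fixes lam bet eta thr :: real and K :: nat
  assumes lam: "0 < lam" "lam < 1" and bet: "0 < bet" "bet \<le> 1/2" and eta: "0 < eta"
begin

section \<open>Log-sum-exp and smoothed softmax weights\<close>

definition logsumexp :: "('x::finite \<Rightarrow> real) \<Rightarrow> real" where
  "logsumexp U = ln (\<Sum>x\<in>UNIV. exp (eta * U x))"

definition softmax :: "('x::finite \<Rightarrow> real) \<Rightarrow> 'x \<Rightarrow> real" where
  "softmax U x = exp (eta * U x) / (\<Sum>z\<in>UNIV. exp (eta * U z))"

definition smooth :: "('x::finite \<Rightarrow> real) \<Rightarrow> 'x \<Rightarrow> real" where
  "smooth w x = (1 - bet) * w x + bet / real CARD('x)"

lemma sum_exp_pos: "0 < (\<Sum>x\<in>UNIV. exp (eta * (U::'x::finite \<Rightarrow> real) x))"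
  by (intro sum_pos) auto

lemma softmax_pos: "0 < softmax U x"
  unfolding softmax_def by (intro divide_pos_pos sum_exp_pos) simp

lemma sum_softmax: "(\<Sum>x\<in>UNIV. softmax U x) = 1"
  unfolding softmax_def using sum_exp_pos[of U]
  by (simp flip: sum_divide_distrib)

lemma softmax_le_1: "softmax U x \<le> 1"
  using member_le_sum[of x UNIV "softmax U"] softmax_pos[of U] sum_softmax[of U]
  by (auto simp: less_imp_le)

text \<open>Since \<open>bet \<le> 1/2\<close>, smoothing at most halves a weight. The second bound
  later controls softmax weights by the smoothed ones that occur in \<open>ratio\<close>.\<close>

lemma smooth_ge:
  fixes w :: "'x::finite \<Rightarrow> real"
  assumes "0 \<le> w x"
  shows "bet / real CARD('x) \<le> smooth w x" and "w x \<le> 2 * smooth w x"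
proof -
  show "bet / real CARD('x) \<le> smooth w x" using assms bet by (simp add: smooth_def)
  have "1/2 * w x \<le> (1 - bet) * w x" using assms bet by (intro mult_right_mono) auto
  then show "w x \<le> 2 * smooth w x" using bet by (simp add: smooth_def add_increasing2)
qed

lemma sum_smooth:
  fixes w :: "'x::finite \<Rightarrow> real"
  assumes "(\<Sum>x\<in>UNIV. w x) = 1"
  shows "(\<Sum>x\<in>UNIV. smooth w x) = 1"
  using assms by (simp add: smooth_def sum.distrib flip: sum_distrib_left)

lemma smooth_pos: "0 \<le> w x \<Longrightarrow> 0 < smooth (w::'x::finite \<Rightarrow> real) x"
  using smooth_ge(1)[of w x] bet by (smt (verit) divide_pos_pos of_nat_0_less_iff zero_less_card_finite)

lemma smooth_le_1:
  fixes w :: "'x::finite \<Rightarrow> real"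
  assumes "(\<Sum>x\<in>UNIV. w x) = 1" "\<And>x. 0 \<le> w x"
  shows "smooth w x \<le> 1"
proof -
  have "smooth w x \<le> (\<Sum>x\<in>UNIV. smooth w x)"
    by (intro member_le_sum) (auto intro!: less_imp_le smooth_pos assms)
  then show ?thesis using sum_smooth[OF assms(1)] by simp
qed

text \<open>Raising one score by \<open>g\<close> multiplies the sum of exponentials by
  \<open>1 + softmax U x * (exp (eta * g) - 1)\<close>; then \<open>ln (1 + u) \<le> u\<close> and
  the quadratic bound on \<open>exp\<close> apply.\<close>

lemma logsumexp_update:
  fixes U :: "'x::finite \<Rightarrow> real"
  assumes "\<bar>eta * g\<bar> \<le> 1"
  shows "logsumexp (U(x := U x + g)) \<le> logsumexp U + softmax U x * (eta * g + (eta * g)\<^sup>2)"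
proof -
  define S where "S = (\<Sum>z\<in>UNIV. exp (eta * U z))"
  have S: "0 < S" unfolding S_def by (rule sum_exp_pos)
  have "(\<Sum>z\<in>UNIV. exp (eta * (U(x := U x + g)) z)) =
        exp (eta * (U x + g)) + (\<Sum>z\<in>UNIV - {x}. exp (eta * U z))"
    by (subst sum.remove[of UNIV x]) (auto intro!: sum.cong)
  also have "(\<Sum>z\<in>UNIV - {x}. exp (eta * U z)) = S - exp (eta * U x)"
    unfolding S_def by (subst sum.remove[of UNIV x]) auto
  also have "exp (eta * (U x + g)) + (S - exp (eta * U x)) = S * (1 + softmax U x * (exp (eta * g) - 1))"
    using S unfolding softmax_def S_def[symmetric] by (simp add: field_simps exp_add)
  finally have eq: "(\<Sum>z\<in>UNIV. exp (eta * (U(x := U x + g)) z)) = S * (1 + softmax U x * (exp (eta * g) - 1))" .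
  have pos: "0 < 1 + softmax U x * (exp (eta * g) - 1)"
    using eq S sum_exp_pos[of "U(x := U x + g)"] by (simp add: zero_less_mult_iff)
  have lse: "logsumexp (U(x := U x + g)) = ln S + ln (1 + softmax U x * (exp (eta * g) - 1))"
    unfolding logsumexp_def eq using S pos by (simp add: ln_mult)
  have "ln (1 + softmax U x * (exp (eta * g) - 1)) \<le> softmax U x * (exp (eta * g) - 1)"
    using ln_le_minus_one[OF pos] by simp
  also have "\<dots> \<le> softmax U x * (eta * g + (eta * g)\<^sup>2)"
    using exp_le_quadratic[OF assms] softmax_pos[of U x] by (intro mult_left_mono) auto
  finally show ?thesis unfolding lse by (simp add: logsumexp_def S_def)
qed

text \<open>Log-sum-exp dominates each single score, hence every convex combination of scores; this
  is what allows comparison with an arbitrary fixed strategy.\<close>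

lemma logsumexp_ge:
  fixes U :: "'x::finite \<Rightarrow> real"
  assumes "\<And>x. 0 \<le> th x" "(\<Sum>x\<in>UNIV. th x) = 1"
  shows "eta * (\<Sum>x\<in>UNIV. th x * U x) \<le> logsumexp U"
proof -
  have le: "eta * U x \<le> logsumexp U" for x
  proof -
    have "exp (eta * U x) \<le> (\<Sum>x\<in>UNIV. exp (eta * U x))" by (intro member_le_sum) auto
    then show ?thesis unfolding logsumexp_def using sum_exp_pos[of U] by (simp add: ln_ge_iff)
  qed
  have "eta * (\<Sum>x\<in>UNIV. th x * U x) = (\<Sum>x\<in>UNIV. th x * (eta * U x))"
    by (simp add: sum_distrib_left mult_ac)
  also have "\<dots> \<le> (\<Sum>x\<in>UNIV. th x * logsumexp U)"
    using assms le by (intro sum_mono mult_left_mono) auto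
  also have "\<dots> = logsumexp U" using assms by (simp flip: sum_distrib_right)
  finally show ?thesis .
qed

section \<open>The learner's strategy and its gradient steps\<close>

definition prior :: "('x::finite \<Rightarrow> real) \<times> ('y::finite \<Rightarrow> 'x \<Rightarrow> real) \<Rightarrow> 'x \<Rightarrow> real" where
  "prior L = smooth (softmax (fst L))"

text \<open>A free guess at the law of the input given output \<open>y\<close>, learnt separately
  for each \<open>y\<close>; it is not derived from \<open>prior L\<close> by Bayes' rule.\<close>

definition posterior :: "('x::finite \<Rightarrow> real) \<times> ('y::finite \<Rightarrow> 'x \<Rightarrow> real) \<Rightarrow> 'y \<Rightarrow> 'x \<Rightarrow> real" where
  "posterior L y = smooth (softmax (snd L y))"

text \<open>Its inverse is the factor by which a data use multiplies the score of a candidate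
  message.\<close>

definition ratio :: "('x::finite \<Rightarrow> real) \<times> ('y::finite \<Rightarrow> 'x \<Rightarrow> real) \<Rightarrow> 'x \<Rightarrow> 'y \<Rightarrow> real" where
  "ratio L x y = prior L x / posterior L y x"

text \<open>The increments are the partial derivatives of \<open>- u * ln (u / v)\<close> in
  \<open>u\<close> and in \<open>v\<close>, at \<open>u / v = ratio L x y\<close>. A given pilot
  letter is sent with probability \<open>lam / CARD('x)\<close>; dividing by it makes them unbiased
  estimates of the gradient.\<close>

fun upd :: "('x::finite \<Rightarrow> real) \<times> ('y::finite \<Rightarrow> 'x \<Rightarrow> real) \<Rightarrow> ('x \<times> 'y) option \<Rightarrow>
    ('x \<Rightarrow> real) \<times> ('y \<Rightarrow> 'x \<Rightarrow> real)" where
  "upd L None = L"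
| "upd L (Some (x, y)) =
    ((fst L)(x := fst L x + real CARD('x) / lam * (- (ln (ratio L x y) + 1))),
     (snd L)(y := (snd L y)(x := snd L y x + real CARD('x) / lam * ratio L x y)))"

definition learn :: "('x::finite \<times> 'y::finite) option list \<Rightarrow> ('x \<Rightarrow> real) \<times> ('y \<Rightarrow> 'x \<Rightarrow> real)" where
  "learn h = foldl upd (\<lambda>_. 0, \<lambda>_ _. 0) h"

lemma prior_pos: "0 < prior L x" and prior_le_1: "prior L x \<le> 1"
  and sum_prior: "(\<Sum>x\<in>UNIV. prior L x) = 1"
  unfolding prior_def
  by (auto intro!: smooth_pos smooth_le_1 sum_smooth less_imp_le[OF softmax_pos] sum_softmax)

lemma posterior_pos: "0 < posterior L y x" and posterior_le_1: "posterior L y x \<le> 1"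
  and sum_posterior: "(\<Sum>x\<in>UNIV. posterior L y x) = 1"
  unfolding posterior_def
  by (auto intro!: smooth_pos smooth_le_1 sum_smooth less_imp_le[OF softmax_pos] sum_softmax)

lemma ratio_pos: "0 < ratio L x y"
  by (simp add: ratio_def prior_pos posterior_pos)

text \<open>Smoothing keeps numerator and denominator in \<open>[bet / CARD('x), 1]\<close>.\<close>

lemma ratio_bounds:
  fixes L :: "('x::finite \<Rightarrow> real) \<times> ('y::finite \<Rightarrow> 'x \<Rightarrow> real)"
  shows "ratio L x y \<le> real CARD('x) / bet" and "\<bar>ln (ratio L x y)\<bar> \<le> ln (real CARD('x) / bet)"
proof -
  have ge: "bet / real CARD('x) \<le> prior L x" "bet / real CARD('x) \<le> posterior L y x"
    unfolding prior_def posterior_def by (auto intro!: smooth_ge less_imp_le[OF softmax_pos])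
  have b0: "0 < bet / real CARD('x)" using bet by simp
  have "ratio L x y \<le> 1 / (bet / real CARD('x))"
    unfolding ratio_def using ge b0 prior_le_1[of L x] prior_pos[of L x] by (intro frac_le) auto
  then show up: "ratio L x y \<le> real CARD('x) / bet" by simp
  have "(bet / real CARD('x)) / 1 \<le> ratio L x y"
    unfolding ratio_def using ge b0 posterior_le_1[of L y x] posterior_pos[of L y x]
    by (intro frac_le) auto
  then have "ln (bet / real CARD('x)) \<le> ln (ratio L x y)" using b0 by simp
  moreover have "ln (bet / real CARD('x)) = - ln (real CARD('x) / bet)"
    using bet by (simp add: ln_div)
  moreover have "ln (ratio L x y) \<le> ln (real CARD('x) / bet)"
    using up ratio_pos[of L x y] by simp
  ultimately show "\<bar>ln (ratio L x y)\<bar> \<le> ln (real CARD('x) / bet)" by auto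
qed

lemma card_div_bet_ge: "1 \<le> real CARD('x::finite) / bet"
proof -
  have "1 \<le> real CARD('x)" using zero_less_card_finite[where 'a='x] by linarith
  then have "bet \<le> real CARD('x)" using bet by linarith
  then show ?thesis using bet by simp
qed

text \<open>Regret potential against the comparator \<open>(q, a)\<close>: one exponential-weights
  learner for the prior and one for each output \<open>y\<close>, each contributing log-sum-exp
  minus the comparator's linear reward.\<close>

definition pot :: "('x::finite \<Rightarrow> real) \<Rightarrow> ('y::finite \<Rightarrow> 'x \<Rightarrow> real) \<Rightarrow>
   ('x \<Rightarrow> real) \<times> ('y \<Rightarrow> 'x \<Rightarrow> real) \<Rightarrow> real" where
  "pot q a L = (logsumexp (fst L) / eta - (\<Sum>x\<in>UNIV. q x * fst L x)) +
     (\<Sum>y\<in>UNIV. logsumexp (snd L y) / eta - (\<Sum>x\<in>UNIV. a y x * snd L y x))"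

lemma pot_nonneg:
  assumes "\<And>x. 0 \<le> q x" "(\<Sum>x\<in>UNIV. q x) = 1" "\<And>y x. 0 \<le> a y x" "\<And>y. (\<Sum>x\<in>UNIV. a y x) = 1"
  shows "0 \<le> pot q a L"
proof -
  have *: "0 \<le> logsumexp U / eta - (\<Sum>x\<in>UNIV. th x * U x)"
    if "\<And>x. 0 \<le> th x" "(\<Sum>x\<in>UNIV. th x) = 1" for th U :: "'a \<Rightarrow> real"
    using logsumexp_ge[OF that, of U] eta by (simp add: field_simps)
  show ?thesis unfolding pot_def
    by (intro add_nonneg_nonneg sum_nonneg *) (use assms in auto)
qed

lemma pot_init:
  fixes q :: "'x::finite \<Rightarrow> real" and a :: "'y::finite \<Rightarrow> 'x \<Rightarrow> real"
  shows "pot q a (learn []) = (1 + real CARD('y)) * ln (real CARD('x)) / eta"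
  by (simp add: pot_def learn_def logsumexp_def add_divide_distrib distrib_right)

lemma sum_fun_upd:
  fixes th U :: "'x::finite \<Rightarrow> real"
  shows "(\<Sum>z\<in>UNIV. th z * (U(x := U x + g)) z) = (\<Sum>z\<in>UNIV. th z * U z) + th x * g"
proof -
  have "(\<Sum>z\<in>UNIV. th z * (U(x := U x + g)) z) = (\<Sum>z\<in>UNIV. th z * U z + (if z = x then th x * g else 0))"
    by (intro sum.cong) (auto simp: algebra_simps)
  then show ?thesis by (simp add: sum.distrib)
qed

text \<open>To first order the potential grows by the linear reward of the learner minus that of the
  comparator. By concavity (\<open>log_ratio_tangent\<close> with slope \<open>r\<close>) the latter
  is at least the comparator's actual value \<open>- q x * ln (q x / a y x)\<close>, up to the
  factor \<open>D\<close>.\<close>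

lemma pot_upd:
  fixes q :: "'x::finite \<Rightarrow> real" and a :: "'y::finite \<Rightarrow> 'x \<Rightarrow> real" and L x y
  defines "A \<equiv> real CARD('x) / bet" and "D \<equiv> real CARD('x) / lam" and "r \<equiv> ratio L x y"
  assumes small: "eta * D * (6 * A) \<le> 1"
    and q: "0 \<le> q x" and a: "0 < a y x"
  shows "pot q a (upd L (Some (x, y))) - pot q a L \<le>
     D * (softmax (fst L) x * (- (ln r + 1)) + softmax (snd L y) x * r - (- q x * ln (q x / a y x)))
     + eta * D\<^sup>2 * (6 * A)"
proof -
  define w where "w = softmax (fst L) x"
  define v where "v = softmax (snd L y) x"
  define g where "g = D * (- (ln r + 1))"
  define k where "k = D * r"
  have D: "0 < D" using lam by (simp add: D_def)
  have A1: "1 \<le> A" unfolding A_def by (rule card_div_bet_ge)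
  have r: "0 < r" "r \<le> A" "\<bar>ln r\<bar> \<le> ln A"
    unfolding r_def A_def by (auto intro: ratio_pos ratio_bounds)
  have lnA: "0 \<le> ln A" "ln A + 1 \<le> A" using A1 ln_le_minus_one[of A] by auto
  have eDA: "eta * D * A \<le> 1"
  proof -
    have "0 \<le> eta * D * A" using eta D A1 by simp
    moreover have "6 * (eta * D * A) \<le> 1" using small by simp
    ultimately show ?thesis by linarith
  qed
  have gb: "\<bar>g\<bar> \<le> D * (ln A + 1)"
    unfolding g_def using D r(3) by (simp add: abs_mult mult_left_mono)
  have "D * (ln A + 1) \<le> D * A" using lnA D by (intro mult_left_mono) auto
  then have "\<bar>eta * g\<bar> \<le> eta * (D * A)" using gb eta by (simp add: abs_mult)
  then have small_g: "\<bar>eta * g\<bar> \<le> 1" using eDA by (simp add: mult.assoc)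
  have "\<bar>eta * k\<bar> \<le> eta * (D * A)"
    unfolding k_def using eta D r by (simp add: abs_mult mult_left_mono)
  then have small_k: "\<bar>eta * k\<bar> \<le> 1" using eDA by (simp add: mult.assoc)
  have w01: "0 \<le> w" "w \<le> 1" and v0: "0 \<le> v"
    unfolding w_def v_def by (auto intro: softmax_le_1 less_imp_le[OF softmax_pos])
  \<comment> \<open>The posterior in the denominator of \<open>r\<close> cancels against the softmax
    weight, which is at most twice as large; so only one factor \<open>A\<close> survives in
    \<open>v * k\<^sup>2\<close>.\<close>
  have vr: "v * r \<le> 2"
  proof -
    have "v \<le> 2 * posterior L y x"
      unfolding v_def posterior_def by (intro smooth_ge less_imp_le[OF softmax_pos])
    then have "v * r \<le> 2 * posterior L y x * r" using r by (intro mult_right_mono) auto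
    also have "\<dots> = 2 * prior L x"
      unfolding r_def ratio_def using posterior_pos[of L y x] by simp
    finally show ?thesis using prior_le_1[of L x] by simp
  qed
  \<comment> \<open>The constant \<open>6\<close> is \<open>4\<close> from the squared logarithm
    plus \<open>2\<close> from \<open>v * r \<le> 2\<close>.\<close>
  have sq: "w * g\<^sup>2 + v * k\<^sup>2 \<le> D\<^sup>2 * (6 * A)"
  proof -
    have "g\<^sup>2 \<le> (D * (ln A + 1))\<^sup>2" using gb by (rule power2_le_iff_abs_le[THEN iffD2, rotated]) (use D lnA in auto)
    also have "\<dots> \<le> D\<^sup>2 * (4 * A)"
      using square_ln_add_one_le[OF A1] by (simp add: power_mult_distrib mult_left_mono)
    finally have "g\<^sup>2 \<le> D\<^sup>2 * (4 * A)" .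
    then have 1: "w * g\<^sup>2 \<le> D\<^sup>2 * (4 * A)"
      using mult_mono[OF w01(2), of "g\<^sup>2" "D\<^sup>2 * (4 * A)"] by simp
    have "v * k\<^sup>2 = D\<^sup>2 * (v * r * r)" by (simp add: k_def power2_eq_square mult_ac)
    also have "\<dots> \<le> D\<^sup>2 * (2 * A)"
      using vr r v0 by (intro mult_left_mono mult_mono) auto
    finally show ?thesis using 1 by (simp add: algebra_simps)
  qed
  have up: "fst (upd L (Some (x, y))) = (fst L)(x := fst L x + g)"
    "snd (upd L (Some (x, y))) = (snd L)(y := (snd L y)(x := snd L y x + k))"
    by (simp_all add: g_def k_def D_def r_def)
  \<comment> \<open>Potential of a single learner. A pilot moves only the prior learner and the
    learner of the observed \<open>y\<close>; all others cancel in the difference.\<close>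
  define h where "h a' U = logsumexp U / eta - (\<Sum>z\<in>UNIV. a' z * U z)" for a' U :: "'x \<Rightarrow> real"
  have h_upd: "h a' (U(x := U x + s)) \<le> h a' U + softmax U x * (s + eta * s\<^sup>2) - a' x * s"
    if "\<bar>eta * s\<bar> \<le> 1" for a' U s
  proof -
    have "logsumexp (U(x := U x + s)) / eta \<le> (logsumexp U + softmax U x * (eta * s + (eta * s)\<^sup>2)) / eta"
      using logsumexp_update[OF that, of U x] eta by (intro divide_right_mono) auto
    also have "\<dots> = logsumexp U / eta + softmax U x * (s + eta * s\<^sup>2)"
      using eta by (simp add: field_simps power2_eq_square)
    finally show ?thesis unfolding h_def sum_fun_upd by simp
  qed
  have pot_h: "pot q a L' = h q (fst L') + (\<Sum>y\<in>UNIV. h (a y) (snd L' y))" for L'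
    by (simp add: pot_def h_def)
  have "(\<Sum>y'\<in>UNIV. h (a y') (snd (upd L (Some (x, y))) y')) =
        h (a y) ((snd L y)(x := snd L y x + k)) + (\<Sum>y'\<in>UNIV - {y}. h (a y') (snd L y'))"
    unfolding up by (subst sum.remove[of UNIV y]) (auto intro!: sum.cong)
  moreover have "(\<Sum>y'\<in>UNIV. h (a y') (snd L y')) = h (a y) (snd L y) + (\<Sum>y'\<in>UNIV - {y}. h (a y') (snd L y'))"
    by (subst sum.remove[of UNIV y]) auto
  ultimately have "pot q a (upd L (Some (x, y))) - pot q a L =
     h q ((fst L)(x := fst L x + g)) - h q (fst L) +
     (h (a y) ((snd L y)(x := snd L y x + k)) - h (a y) (snd L y))"
    unfolding pot_h up(1) by simp
  also have "\<dots> \<le> w * (g + eta * g\<^sup>2) - q x * g + (v * (k + eta * k\<^sup>2) - a y x * k)"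
    using h_upd[OF small_g, of q "fst L"] h_upd[OF small_k, of "a y" "snd L y"]
    by (simp add: w_def v_def)
  also have "\<dots> = w * g + v * k - (q x * g + a y x * k) + eta * (w * g\<^sup>2 + v * k\<^sup>2)"
    by (simp add: algebra_simps)
  also have "\<dots> \<le> w * g + v * k - D * (- q x * ln (q x / a y x)) + eta * (D\<^sup>2 * (6 * A))"
  proof -
    have "D * (- q x * ln (q x / a y x)) \<le> D * (- q x * (ln r + 1) + a y x * r)"
      using log_ratio_tangent[OF q a r(1)] D by (intro mult_left_mono) auto
    also have "\<dots> = q x * g + a y x * k" by (simp add: g_def k_def algebra_simps)
    finally have "D * (- q x * ln (q x / a y x)) \<le> q x * g + a y x * k" .
    moreover have "eta * (w * g\<^sup>2 + v * k\<^sup>2) \<le> eta * (D\<^sup>2 * (6 * A))"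
      using sq eta by (intro mult_left_mono) auto
    ultimately show ?thesis by linarith
  qed
  finally show ?thesis
    by (simp add: w_def v_def g_def k_def algebra_simps)
qed


text \<open>As posterior times ratio is the prior, the left side is a linear form in the smoothed
  weights. The softmax parts give the right side; the uniform parts give a negative multiple of
  \<open>r - 1 - ln r \<ge> 0\<close>. This ties the score gained on data to the reward credited at
  pilots.\<close>

lemma prior_ln_ratio_le:
  "prior L x * ln (ratio L x y) \<le>
     - (1 - bet) * (softmax (fst L) x * (- (ln (ratio L x y) + 1)) + softmax (snd L y) x * ratio L x y)"
proof -
  define r where "r = ratio L x y"
  have r: "0 < r" unfolding r_def by (rule ratio_pos)
  have "posterior L y x * r = prior L x"
    unfolding r_def ratio_def using posterior_pos[of L y x] by simp
  then have "prior L x * ln r = prior L x * (ln r + 1) - posterior L y x * r"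
    by (simp add: algebra_simps)
  also have "\<dots> = - (1 - bet) * (softmax (fst L) x * (- (ln r + 1)) + softmax (snd L y) x * r)
      - bet / real CARD('a) * (r - 1 - ln r)"
    unfolding prior_def posterior_def smooth_def by (simp add: algebra_simps)
  finally have "prior L x * ln r = - (1 - bet) * (softmax (fst L) x * (- (ln r + 1)) + softmax (snd L y) x * r)
      - bet / real CARD('a) * (r - 1 - ln r)" .
  moreover have "0 \<le> bet / real CARD('a) * (r - 1 - ln r)"
    using ln_le_minus_one[OF r] bet by (intro mult_nonneg_nonneg) auto
  ultimately show ?thesis unfolding r_def by linarith
qed

text \<open>One step of the exponential supermartingale. The factor \<open>kap\<close> discounts the
  potential by the fraction of data uses and by the smoothing, so that the learner's own linear
  reward enters data and pilot terms with opposite signs and cancels. The comparator's value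
  \<open>F\<close> and second-order errors remain.\<close>

lemma step_exp:
  fixes L :: "('x::finite \<Rightarrow> real) \<times> ('y::finite \<Rightarrow> 'x \<Rightarrow> real)" and W :: "'x \<Rightarrow> 'y pmf"
    and q :: "'x \<Rightarrow> real" and a :: "'y \<Rightarrow> 'x \<Rightarrow> real" and rho :: real
  defines "A \<equiv> real CARD('x) / bet" and "D \<equiv> real CARD('x) / lam"
    and "kap \<equiv> (1 - bet) * (1 - lam)"
  defines "B \<equiv> 2 * ln A + 5"
  defines "F \<equiv> (\<Sum>x\<in>UNIV. \<Sum>y\<in>UNIV. pmf (W x) y * (- q x * ln (q x / a y x)))"
  assumes small: "eta * D * (6 * A) \<le> 1" and rho: "0 < rho" "rho * D * B \<le> 1"
    and q: "\<And>x. 0 \<le> q x" "(\<Sum>x\<in>UNIV. q x) = 1"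
    and a: "\<And>y x. bet / real CARD('x) \<le> a y x" "\<And>y. (\<Sum>x\<in>UNIV. a y x) = 1"
  shows "(1 - lam) * (\<Sum>x\<in>UNIV. prior L x * (\<Sum>y\<in>UNIV. pmf (W x) y * exp (rho * ln (ratio L x y)))) +
     lam / real CARD('x) * (\<Sum>x\<in>UNIV. \<Sum>y\<in>UNIV. pmf (W x) y *
        exp (rho * (kap * (pot q a (upd L (Some (x, y))) - pot q a L))))
     \<le> exp (- (rho * kap * F) + rho\<^sup>2 * (2 * real CARD('x) * D * B\<^sup>2) + rho * (6 * eta * real CARD('x) * D * A))"
proof -
  define d where "d = real CARD('x)"
  define r where "r x y = ratio L x y" for x y
  define coef where "coef x y = softmax (fst L) x * (- (ln (r x y) + 1)) + softmax (snd L y) x * r x y" for x y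
  define f where "f x y = - q x * ln (q x / a y x)" for x y
  define e where "e x y = D * (coef x y - f x y) + eta * D\<^sup>2 * (6 * A)" for x y
  \<comment> \<open>Weighted by the channel in \<open>y\<close> but unweighted in \<open>x\<close>:
    a pilot averages with \<open>S g / d\<close>, while for data the weight \<open>prior L x\<close>
    is part of \<open>g\<close>.\<close>
  define S where "S g = (\<Sum>x\<in>UNIV. \<Sum>y\<in>UNIV. pmf (W x) y * g x y)" for g :: "'x \<Rightarrow> 'y \<Rightarrow> real"
  have d1: "1 \<le> d" unfolding d_def using zero_less_card_finite[where 'a='x] by linarith
  have D: "0 < D" using lam by (simp add: D_def)
  have lamD: "lam * D = d" using lam by (simp add: D_def d_def)
  have D1: "1 \<le> D" using d1 lam lamD mult_right_mono[of lam 1 D] D by linarith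
  have A1: "1 \<le> A" unfolding A_def by (rule card_div_bet_ge)
  have lnA: "0 \<le> ln A" using A1 by simp
  have B: "5 \<le> B" "ln A \<le> B" using lnA by (auto simp: B_def)
  have kap: "0 \<le> kap" "kap \<le> 1"
    unfolding kap_def using bet lam by (auto intro!: mult_nonneg_nonneg mult_le_one)
  have a0: "0 < a y x" for y x using a(1)[of y x] bet by (smt (verit) divide_pos_pos of_nat_0_less_iff zero_less_card_finite)
  have a1: "a y x \<le> 1" for y x
    using member_le_sum[of x UNIV "a y"] a(2)[of y] a0[of y] by (auto simp: less_imp_le)
  have q1: "q x \<le> 1" for x
    using member_le_sum[of x UNIV q] q by auto
  have r: "0 < r x y" "r x y \<le> A" "\<bar>ln (r x y)\<bar> \<le> ln A" for x y
    unfolding r_def A_def by (auto intro: ratio_pos ratio_bounds)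
  have fb: "\<bar>f x y\<bar> \<le> 1 + ln A" for x y
  proof (cases "q x = 0")
    case False
    then have qx: "0 < q x" using q(1)[of x] by simp
    have "f x y = - q x * ln (q x) + q x * ln (a y x)"
      using qx a0[of y x] by (simp add: f_def ln_div algebra_simps)
    moreover have "0 \<le> - q x * ln (q x)" "- q x * ln (q x) \<le> 1"
      using neg_xlnx_bounds[OF q(1) q1] by auto
    moreover have "ln (bet / real CARD('x)) \<le> ln (a y x)"
      using a(1)[of y x] bet by (subst ln_le_cancel_iff) (auto intro: a0)
    then have "\<bar>ln (a y x)\<bar> \<le> ln A"
      using bet a0[of y x] a1[of y x] by (simp add: A_def ln_div)
    then have "\<bar>q x * ln (a y x)\<bar> \<le> 1 * ln A"
      unfolding abs_mult using q1[of x] qx by (intro mult_mono) auto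
    ultimately show ?thesis by linarith
  qed (use lnA in \<open>simp add: f_def\<close>)
  have cb: "\<bar>coef x y\<bar> \<le> ln A + 3" for x y
  proof -
    have "softmax (snd L y) x \<le> 2 * posterior L y x"
      unfolding posterior_def by (intro smooth_ge less_imp_le[OF softmax_pos])
    then have "softmax (snd L y) x * r x y \<le> 2 * posterior L y x * r x y"
      using r by (intro mult_right_mono) (auto simp: less_imp_le)
    also have "\<dots> = 2 * prior L x"
      unfolding r_def ratio_def using posterior_pos[of L y x] by simp
    finally have 1: "softmax (snd L y) x * r x y \<le> 2" using prior_le_1[of L x] by simp
    have 2: "0 \<le> softmax (snd L y) x * r x y"
      using r(1)[of x y] softmax_pos[of "snd L y" x] by simp
    have tri: "\<bar>u + v\<bar> \<le> ln A + 3" if "\<bar>u\<bar> \<le> 1 * (ln A + 1)" "v \<le> 2" "0 \<le> v" for u v :: real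
      using that by (simp add: abs_le_iff)
    have "\<bar>softmax (fst L) x * (- (ln (r x y) + 1))\<bar> \<le> 1 * (ln A + 1)"
      unfolding abs_mult using r(3)[of x y] softmax_pos[of "fst L" x] softmax_le_1[of "fst L" x]
      by (intro mult_mono) auto
    then show ?thesis unfolding coef_def using 1 2 by (rule tri)
  qed
  \<comment> \<open>\<open>B\<close> adds \<open>ln A + 3\<close> for the learner's reward,
    \<open>ln A + 1\<close> for the comparator and \<open>1\<close> for the second-order
    term.\<close>
  have eb: "\<bar>e x y\<bar> \<le> D * B" for x y
  proof -
    have "e x y = D * (coef x y - f x y + eta * D * (6 * A))"
      by (simp add: e_def algebra_simps power2_eq_square)
    moreover have "\<bar>coef x y - f x y + eta * D * (6 * A)\<bar> \<le> B"
    proof -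
      have "0 \<le> eta * D * (6 * A)" using eta D A1 by simp
      then show ?thesis using cb[of x y] fb[of x y] small unfolding B_def by linarith
    qed
    ultimately show ?thesis using D by (simp add: abs_mult)
  qed
  have S_mono: "S g \<le> S g'" if "\<And>x y. g x y \<le> g' x y" for g g'
    unfolding S_def using that by (intro sum_mono mult_left_mono) auto
  have S_add: "S (\<lambda>x y. g x y + g' x y) = S g + S g'" for g g'
    unfolding S_def by (simp add: distrib_left sum.distrib)
  have S_mult: "S (\<lambda>x y. c * g x y) = c * S g" for c g
    unfolding S_def by (simp add: sum_distrib_left mult_ac)
  have S_dep: "S (\<lambda>x y. g x) = (\<Sum>x\<in>UNIV. g x)" for g
    unfolding S_def by (simp add: sum_pmf_eq_1 flip: sum_distrib_right)
  have S_const: "S (\<lambda>x y. c) = d * c" for c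
    by (subst S_dep) (simp add: d_def)
  have data: "S (\<lambda>x y. prior L x * exp (rho * ln (r x y))) \<le>
     1 + rho * S (\<lambda>x y. prior L x * ln (r x y)) + (rho * B)\<^sup>2"
  proof -
    have "exp (rho * ln (r x y)) \<le> 1 + rho * ln (r x y) + (rho * B)\<^sup>2" for x y
    proof -
      have le: "\<bar>rho * ln (r x y)\<bar> \<le> rho * B"
        using r(3)[of x y] rho B by (simp add: abs_mult)
      have "rho * B * 1 \<le> rho * B * D"
        using rho B D1 by (intro mult_left_mono) auto
      then have "\<bar>rho * ln (r x y)\<bar> \<le> 1" using le rho by (simp add: mult_ac)
      from exp_le_quadratic[OF this] have "exp (rho * ln (r x y)) \<le> 1 + rho * ln (r x y) + (rho * ln (r x y))\<^sup>2" .
      moreover have "(rho * ln (r x y))\<^sup>2 \<le> (rho * B)\<^sup>2"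
        using le rho B by (subst power2_le_iff_abs_le) auto
      ultimately show ?thesis by linarith
    qed
    then have "S (\<lambda>x y. prior L x * exp (rho * ln (r x y))) \<le>
      S (\<lambda>x y. prior L x * (1 + rho * ln (r x y) + (rho * B)\<^sup>2))"
      by (intro S_mono mult_left_mono) (auto simp: less_imp_le[OF prior_pos])
    also have "\<dots> = S (\<lambda>x y. rho * (prior L x * ln (r x y)) + prior L x * (1 + (rho * B)\<^sup>2))"
      by (simp add: algebra_simps)
    also have "\<dots> = rho * S (\<lambda>x y. prior L x * ln (r x y)) + (\<Sum>x\<in>UNIV. prior L x * (1 + (rho * B)\<^sup>2))"
      by (simp only: S_add S_mult S_dep)
    also have "(\<Sum>x\<in>UNIV. prior L x * (1 + (rho * B)\<^sup>2)) = 1 + (rho * B)\<^sup>2"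
      by (simp add: sum_prior flip: sum_distrib_right)
    finally show ?thesis by simp
  qed
  have data2: "S (\<lambda>x y. prior L x * ln (r x y)) \<le> - (1 - bet) * S coef"
  proof -
    have "S (\<lambda>x y. prior L x * ln (r x y)) \<le> S (\<lambda>x y. - (1 - bet) * coef x y)"
      unfolding coef_def r_def by (intro S_mono prior_ln_ratio_le)
    then show ?thesis by (simp only: S_mult)
  qed
  have pilot: "S (\<lambda>x y. exp (rho * (kap * (pot q a (upd L (Some (x, y))) - pot q a L)))) \<le>
     d * (1 + (rho * (D * B))\<^sup>2) + rho * kap * (D * (S coef - F) + d * (eta * D\<^sup>2 * (6 * A)))"
  proof -
    have "exp (rho * (kap * (pot q a (upd L (Some (x, y))) - pot q a L))) \<le>
       1 + (rho * (D * B))\<^sup>2 + rho * kap * (D * coef x y + - D * f x y + eta * D\<^sup>2 * (6 * A))" for x y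
    proof -
      have pe: "pot q a (upd L (Some (x, y))) - pot q a L \<le> e x y"
        using pot_upd[of q x a y L] small q(1) a0
        unfolding e_def coef_def f_def r_def A_def D_def by (simp add: algebra_simps)
      have le: "\<bar>rho * (kap * e x y)\<bar> \<le> rho * (D * B)"
      proof -
        have "kap * \<bar>e x y\<bar> \<le> 1 * (D * B)" using kap eb by (intro mult_mono) auto
        then show ?thesis using rho kap by (simp add: abs_mult)
      qed
      then have "\<bar>rho * (kap * e x y)\<bar> \<le> 1" using rho by (simp add: mult.assoc)
      from exp_le_quadratic[OF this] have "exp (rho * (kap * e x y)) \<le> 1 + rho * (kap * e x y) + (rho * (kap * e x y))\<^sup>2" .
      moreover have "(rho * (kap * e x y))\<^sup>2 \<le> (rho * (D * B))\<^sup>2"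
        using le rho B D by (subst power2_le_iff_abs_le) auto
      moreover have "exp (rho * (kap * (pot q a (upd L (Some (x, y))) - pot q a L))) \<le> exp (rho * (kap * e x y))"
        using pe rho kap by (simp add: mult_left_mono)
      moreover have "rho * (kap * e x y) = rho * kap * (D * coef x y + - D * f x y + eta * D\<^sup>2 * (6 * A))"
        by (simp add: e_def algebra_simps)
      ultimately show ?thesis by linarith
    qed
    then have "S (\<lambda>x y. exp (rho * (kap * (pot q a (upd L (Some (x, y))) - pot q a L)))) \<le>
       S (\<lambda>x y. 1 + (rho * (D * B))\<^sup>2 + rho * kap * (D * coef x y + - D * f x y + eta * D\<^sup>2 * (6 * A)))"
      by (intro S_mono)
    also have "\<dots> = d * (1 + (rho * (D * B))\<^sup>2) + rho * kap * (D * S coef + - D * S f + d * (eta * D\<^sup>2 * (6 * A)))"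
      by (simp only: S_add S_mult S_const) (simp add: algebra_simps)
    also have "S f = F" by (simp add: S_def F_def f_def)
    finally show ?thesis by (simp add: algebra_simps)
  qed
  have data_eq: "(\<Sum>x\<in>UNIV. prior L x * (\<Sum>y\<in>UNIV. pmf (W x) y * exp (rho * ln (ratio L x y)))) =
     S (\<lambda>x y. prior L x * exp (rho * ln (r x y)))"
    by (simp add: S_def r_def sum_distrib_left mult_ac)
  have "(1 - lam) * S (\<lambda>x y. prior L x * exp (rho * ln (r x y))) +
     lam / d * S (\<lambda>x y. exp (rho * (kap * (pot q a (upd L (Some (x, y))) - pot q a L)))) \<le>
     (1 - lam) * (1 + rho * (- (1 - bet) * S coef) + (rho * B)\<^sup>2) +
     lam / d * (d * (1 + (rho * (D * B))\<^sup>2) + rho * kap * (D * (S coef - F) + d * (eta * D\<^sup>2 * (6 * A))))"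
  proof (intro add_mono mult_left_mono pilot)
    show "S (\<lambda>x y. prior L x * exp (rho * ln (r x y))) \<le> 1 + rho * (- (1 - bet) * S coef) + (rho * B)\<^sup>2"
      using data mult_left_mono[OF data2, of rho] rho by linarith
  qed (use lam d1 in auto)
  also have "\<dots> = (1 - lam) * (1 + (rho * B)\<^sup>2) - rho * kap * S coef +
     (lam * (1 + (rho * (D * B))\<^sup>2) + rho * kap * (lam * D / d * (S coef - F) + (lam * D) * (eta * D * (6 * A))))"
    using d1 by (simp add: kap_def field_simps power2_eq_square)
  \<comment> \<open>Because \<open>lam * D = d\<close>, the two terms with \<open>S coef\<close>
    cancel. The squared pilot increment of order \<open>D\<^sup>2\<close> is weighted by
    \<open>lam\<close> and so costs only \<open>d * D\<close>.\<close>
  also have "\<dots> = 1 - rho * kap * F + ((1 - lam) * (rho * B)\<^sup>2 + d * (rho\<^sup>2 * D * B\<^sup>2)) + rho * (kap * (d * (eta * D * (6 * A))))"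
  proof -
    have 1: "lam * D / d = 1" using lamD d1 by simp
    have 2: "lam * (1 + (rho * (D * B))\<^sup>2) = lam + (lam * D) * (rho\<^sup>2 * D * B\<^sup>2)"
      by (simp add: power2_eq_square algebra_simps)
    show ?thesis unfolding 1 2 unfolding lamD by (simp add: algebra_simps)
  qed
  also have "\<dots> \<le> 1 - rho * kap * F + rho\<^sup>2 * (2 * d * D * B\<^sup>2) + rho * (6 * eta * d * D * A)"
  proof -
    have "(1 - lam) * (rho * B)\<^sup>2 \<le> d * D * (rho * B)\<^sup>2"
      using lam d1 D1 mult_mono[OF d1 D1] by (intro mult_right_mono) auto
    moreover have "d * (rho\<^sup>2 * D * B\<^sup>2) = d * D * (rho * B)\<^sup>2"
      by (simp add: power_mult_distrib mult_ac)
    moreover have "kap * (d * (eta * D * (6 * A))) \<le> 1 * (d * (eta * D * (6 * A)))"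
      using kap d1 eta D A1 by (intro mult_right_mono) auto
    then have "rho * (kap * (d * (eta * D * (6 * A)))) \<le> rho * (1 * (d * (eta * D * (6 * A))))"
      using rho by (intro mult_left_mono) auto
    ultimately show ?thesis by (simp add: power_mult_distrib mult_ac)
  qed
  also have "\<dots> \<le> exp (- (rho * kap * F) + rho\<^sup>2 * (2 * d * D * B\<^sup>2) + rho * (6 * eta * d * D * A))"
    using exp_ge_add_one_self[of "- (rho * kap * F) + rho\<^sup>2 * (2 * d * D * B\<^sup>2) + rho * (6 * eta * d * D * A)"]
    by linarith
  finally show ?thesis unfolding data_eq d_def S_def .
qed

end

section \<open>The coding scheme\<close>

lemma expectation_bind_finite:
  fixes h :: "'b \<Rightarrow> real"
  assumes "finite (set_pmf p)" "\<And>x. x \<in> set_pmf p \<Longrightarrow> finite (set_pmf (f x))"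
  shows "measure_pmf.expectation (bind_pmf p f) h =
    measure_pmf.expectation p (\<lambda>x. measure_pmf.expectation (f x) h)"
  using assms
  by (subst pmf_expectation_bind[of "set_pmf p"])
     (auto simp: integral_measure_pmf[of "set_pmf p"])

lemma expectation_mono_finite:
  fixes f g :: "'a \<Rightarrow> real"
  assumes "finite (set_pmf p)" "\<And>x. x \<in> set_pmf p \<Longrightarrow> f x \<le> g x"
  shows "measure_pmf.expectation p f \<le> measure_pmf.expectation p g"
  using assms by (intro integral_mono_AE AE_pmfI integrable_measure_pmf_finite) auto

lemma expectation_finite_UNIV:
  fixes f :: "'a::finite \<Rightarrow> real"
  shows "measure_pmf.expectation p f = (\<Sum>x\<in>UNIV. pmf p x * f x)"
  by (subst integral_measure_pmf[of UNIV]) auto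

lemma expectation_sum_add:
  fixes G :: "'b \<Rightarrow> 'a \<Rightarrow> real"
  assumes "finite (set_pmf p)"
  shows "measure_pmf.expectation p (\<lambda>x. (\<Sum>m\<in>M. G m x) + k) =
    (\<Sum>m\<in>M. measure_pmf.expectation p (G m)) + k"
  using assms by (simp add: integrable_measure_pmf_finite)

lemma expectation_Pi_pmf_component:
  fixes f :: "'b \<Rightarrow> real"
  assumes "finite I" "i \<in> I"
  shows "measure_pmf.expectation (Pi_pmf I dflt p) (\<lambda>c. f (c i)) = measure_pmf.expectation (p i) f"
proof -
  have "measure_pmf.expectation (Pi_pmf I dflt p) (\<lambda>c. f (c i)) =
    measure_pmf.expectation (map_pmf (\<lambda>c. c i) (Pi_pmf I dflt p)) f"
    by simp
  also have "map_pmf (\<lambda>c. c i) (Pi_pmf I dflt p) = p i"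
    using assms by (simp add: Pi_pmf_component)
  finally show ?thesis .
qed

lemma expectation_Pi_pmf_two_components:
  fixes f g :: "'b::finite \<Rightarrow> real"
  assumes I: "finite I" "i \<in> I" "j \<in> I" "i \<noteq> j" and nonneg: "\<And>x. 0 \<le> f x" "\<And>x. 0 \<le> g x"
  shows "measure_pmf.expectation (Pi_pmf I dflt p) (\<lambda>c. f (c i) * g (c j)) =
     measure_pmf.expectation (p i) f * measure_pmf.expectation (p j) g"
proof -
  \<comment> \<open>All coordinates other than \<open>i\<close> and \<open>j\<close> get the factor
    \<open>1\<close>, so that the product formula over \<open>I\<close> applies.\<close>
  define F where "F k = (if k = i then f else if k = j then g else (\<lambda>_. 1))" for k
  have prod2: "(\<Prod>k\<in>I. G k) = G i * G j" if "\<And>k. k \<noteq> i \<Longrightarrow> k \<noteq> j \<Longrightarrow> G k = 1" for G :: "_ \<Rightarrow> real"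
  proof -
    have "(\<Prod>k\<in>I. G k) = (\<Prod>k\<in>{i, j}. G k)"
      using I that by (intro prod.mono_neutral_right) auto
    then show ?thesis using I by simp
  qed
  have "measure_pmf.expectation (Pi_pmf I dflt p) (\<lambda>c. \<Prod>k\<in>I. F k (c k)) =
     (\<Prod>k\<in>I. measure_pmf.expectation (p k) (F k))"
    using I nonneg
    by (intro expectation_prod_Pi_pmf) (auto simp: F_def intro!: integrable_measure_pmf_finite)
  also have "(\<lambda>c. \<Prod>k\<in>I. F k (c k)) = (\<lambda>c. f (c i) * g (c j))"
    using I by (subst prod2) (auto simp: F_def)
  also have "(\<Prod>k\<in>I. measure_pmf.expectation (p k) (F k)) =
     measure_pmf.expectation (p i) f * measure_pmf.expectation (p j) g"
    using I by (subst prod2) (auto simp: F_def)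
  finally show ?thesis .
qed

context scheme
begin

section \<open>Randomness, decoder state and trajectories\<close>

definition pilot_pmf :: "'x::finite option pmf" where
  "pilot_pmf = bind_pmf (bernoulli_pmf lam)
     (\<lambda>b. if b then map_pmf Some (pmf_of_set UNIV) else return_pmf None)"

definition prior_pmf :: "('x::finite \<Rightarrow> real) \<times> ('y::finite \<Rightarrow> 'x \<Rightarrow> real) \<Rightarrow> 'x pmf" where
  "prior_pmf L = embed_pmf (prior L)"

definition blocks :: "bool list set" where
  "blocks = {m. length m = K}"

definition block :: "(nat \<Rightarrow> bool) \<Rightarrow> nat \<Rightarrow> bool list" where
  "block b j = map b [j * K..<j * K + K]"

text \<open>A codebook letter is indexed by the pilot history, which determines the prior it is drawn
  from, and by the message block.\<close>

definition codebook :: "nat \<Rightarrow> (('x::finite \<times> 'y::finite) option list \<times> bool list \<Rightarrow> 'x) pmf" where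
  "codebook i = Pi_pmf ({h. length h = i} \<times> blocks) undefined (\<lambda>(h, m). prior_pmf (learn h))"

definition step_rnd ::
  "nat \<Rightarrow> ('x::finite option \<times> (('x \<times> 'y::finite) option list \<times> bool list \<Rightarrow> 'x)) pmf" where
  "step_rnd i = pair_pmf pilot_pmf (codebook i)"

text \<open>The decoder state consists of the pilot history, the list of decoded blocks and the metric of
  each candidate for the current block.\<close>

fun dstep :: "('x::finite \<times> 'y::finite) option list \<times> bool list list \<times> (bool list \<Rightarrow> real) \<Rightarrow>
    ('x option \<times> (('x \<times> 'y) option list \<times> bool list \<Rightarrow> 'x)) \<times> 'y \<Rightarrow>
    ('x \<times> 'y) option list \<times> bool list list \<times> (bool list \<Rightarrow> real)" where
  "dstep (h, D, Z) ((Some x, c), y) = (h @ [Some (x, y)], D, Z)"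
| "dstep (h, D, Z) ((None, c), y) =
    (let Z' = (\<lambda>m. Z m / ratio (learn h) (c (h, m)) y) in
     if \<exists>m\<in>blocks. thr \<le> Z' m
     then (h @ [None], D @ [SOME m. m \<in> blocks \<and> thr \<le> Z' m], \<lambda>_. 1)
     else (h @ [None], D, Z'))"

definition run where "run t = foldl dstep ([], [], \<lambda>_. 1) t"
definition hist where "hist t = fst (run t)"
definition decoded where "decoded t = fst (snd (run t))"
definition metric where "metric t = snd (snd (run t))"
text \<open>The block being sent is indexed by the number of blocks decoded so far, rightly or
  wrongly; feedback and common randomness let the encoder compute this number.\<close>

definition cur where "cur b t = block b (length (decoded t))"
definition err where "err b t \<longleftrightarrow> (\<exists>j<length (decoded t). decoded t ! j \<noteq> block b j)"

definition new_metric where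
  "new_metric t c y m = metric t m / ratio (learn (hist t)) (c (hist t, m)) y"

definition input :: "(nat \<Rightarrow> bool) \<Rightarrow>
    (('x::finite option \<times> (('x \<times> 'y::finite) option list \<times> bool list \<Rightarrow> 'x)) \<times> 'y) list \<Rightarrow>
    'x option \<times> (('x \<times> 'y) option list \<times> bool list \<Rightarrow> 'x) \<Rightarrow> 'x" where
  "input b t s = (case fst s of Some x \<Rightarrow> x | None \<Rightarrow> snd s (hist t, cur b t))"

text \<open>Draws the common randomness of each use just before that use, which suits stepwise
  conditional expectations; \<open>traj_eq_bind_rnd_list\<close> shows that drawing it all in
  advance gives the same law.\<close>

primrec traj :: "(nat \<Rightarrow> 'x::finite \<Rightarrow> 'y::finite pmf) \<Rightarrow> (nat \<Rightarrow> bool) \<Rightarrow> nat \<Rightarrow>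
    (('x option \<times> (('x \<times> 'y) option list \<times> bool list \<Rightarrow> 'x)) \<times> 'y) list pmf" where
  "traj W b 0 = return_pmf []"
| "traj W b (Suc i) = bind_pmf (traj W b i) (\<lambda>t. bind_pmf (step_rnd i)
     (\<lambda>s. map_pmf (\<lambda>y. t @ [(s, y)]) (W i (input b t s))))"

lemma run_Nil [simp]: "hist [] = []" "decoded [] = []" "metric [] = (\<lambda>_. 1)"
  by (simp_all add: run_def hist_def decoded_def metric_def)

lemma run_pilot [simp]:
  "hist (t @ [((Some x, c), y)]) = hist t @ [Some (x, y)]"
  "decoded (t @ [((Some x, c), y)]) = decoded t"
  "metric (t @ [((Some x, c), y)]) = metric t"
  by (cases "run t"; simp add: run_def hist_def decoded_def metric_def)+

lemma hist_data [simp]: "hist (t @ [((None, c), y)]) = hist t @ [None]"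
  by (cases "run t") (simp add: run_def hist_def Let_def)

lemma decoded_data:
  "decoded (t @ [((None, c), y)]) = (if \<exists>m\<in>blocks. thr \<le> new_metric t c y m
     then decoded t @ [SOME m. m \<in> blocks \<and> thr \<le> new_metric t c y m] else decoded t)"
  by (cases "run t") (simp add: run_def hist_def decoded_def metric_def new_metric_def Let_def)

lemma metric_data:
  "metric (t @ [((None, c), y)]) = (if \<exists>m\<in>blocks. thr \<le> new_metric t c y m
     then (\<lambda>_. 1) else new_metric t c y)"
  by (cases "run t")
    (auto simp add: run_def hist_def decoded_def metric_def new_metric_def Let_def fun_eq_iff)

text \<open>Hides the choice operator of the decoder: all later arguments need only that the decoded
  block reached \<open>thr\<close>, or that every block is still below it.\<close>

lemma decoded_data_cases:
  obtains (decode) m where "m \<in> blocks" "thr \<le> new_metric t c y m"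
      "decoded (t @ [((None, c), y)]) = decoded t @ [m]" "metric (t @ [((None, c), y)]) = (\<lambda>_. 1)"
  | (continue) "\<And>m. m \<in> blocks \<Longrightarrow> new_metric t c y m < thr"
      "decoded (t @ [((None, c), y)]) = decoded t" "metric (t @ [((None, c), y)]) = new_metric t c y"
proof (cases "\<exists>m\<in>blocks. thr \<le> new_metric t c y m")
  case True
  define m where "m = (SOME m. m \<in> blocks \<and> thr \<le> new_metric t c y m)"
  have "\<exists>m. m \<in> blocks \<and> thr \<le> new_metric t c y m" using True by blast
  then have m: "m \<in> blocks \<and> thr \<le> new_metric t c y m" unfolding m_def by (rule someI_ex)
  show ?thesis
  proof (rule decode)
    show "m \<in> blocks" "thr \<le> new_metric t c y m" using m by auto
    show "decoded (t @ [((None, c), y)]) = decoded t @ [m]"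
      unfolding decoded_data m_def if_P[OF True] ..
    show "metric (t @ [((None, c), y)]) = (\<lambda>_. 1)"
      unfolding metric_data if_P[OF True] ..
  qed
next
  case False
  show ?thesis
  proof (rule continue)
    show "new_metric t c y m < thr" if "m \<in> blocks" for m
      using False that by (meson not_le)
    show "decoded (t @ [((None, c), y)]) = decoded t"
      unfolding decoded_data if_not_P[OF False] ..
    show "metric (t @ [((None, c), y)]) = new_metric t c y"
      unfolding metric_data if_not_P[OF False] ..
  qed
qed

lemma length_hist [simp]: "length (hist t) = length t"
proof (induction t rule: rev_induct)
  case (snoc e t)
  obtain z c y where "e = ((z, c), y)" by (metis surj_pair)
  then show ?case using snoc by (cases z) auto
qed simp

lemma metric_pos: "0 < metric t m"
proof (induction t arbitrary: m rule: rev_induct)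
  case (snoc e t)
  obtain z c y where e: "e = ((z, c), y)" by (metis surj_pair)
  show ?case
  proof (cases z)
    case None
    have "0 < new_metric t c y m" for m
      unfolding new_metric_def by (intro divide_pos_pos snoc ratio_pos)
    then show ?thesis unfolding e None by (simp add: metric_data)
  qed (use snoc e in auto)
qed simp

lemma length_decoded_le: "length (decoded t) \<le> length t"
proof (induction t rule: rev_induct)
  case (snoc e t)
  obtain z c y where e: "e = ((z, c), y)" by (metis surj_pair)
  show ?case
    using snoc unfolding e by (cases z) (auto simp: decoded_data)
qed simp

lemma block_in_blocks [simp]: "block b j \<in> blocks" and cur_in_blocks [simp]: "cur b t \<in> blocks"
  by (simp_all add: blocks_def block_def cur_def)

lemma finite_blocks [simp]: "finite blocks" and card_blocks: "card blocks = 2 ^ K"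
  using finite_lists_length_eq[of "UNIV :: bool set" K] card_lists_length_eq[of "UNIV :: bool set" K]
  by (simp_all add: blocks_def)

lemma finite_hists [simp]: "finite {h :: ('x::finite \<times> 'y::finite) option list. length h = i}"
  using finite_lists_length_eq[of "UNIV :: ('x \<times> 'y) option set" i] by simp

lemma pmf_prior_pmf [simp]: "pmf (prior_pmf L) x = prior L x"
  unfolding prior_pmf_def
  by (rule pmf_embed_pmf)
     (auto simp: less_imp_le[OF prior_pos] nn_integral_count_space_finite sum_prior sum_ennreal)

lemma expectation_pilot_pmf:
  fixes f :: "'x::finite option \<Rightarrow> real"
  shows "measure_pmf.expectation pilot_pmf f =
     (1 - lam) * f None + lam / real CARD('x) * (\<Sum>x\<in>UNIV. f (Some x))"
proof -
  have "measure_pmf.expectation pilot_pmf f = measure_pmf.expectation (bernoulli_pmf lam)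
     (\<lambda>b. measure_pmf.expectation (if b then map_pmf Some (pmf_of_set UNIV) else return_pmf None) f)"
    unfolding pilot_pmf_def by (intro expectation_bind_finite) auto
  also have "\<dots> = lam * measure_pmf.expectation (pmf_of_set UNIV) (\<lambda>x. f (Some x)) + (1 - lam) * f None"
    using lam by simp
  also have "measure_pmf.expectation (pmf_of_set UNIV) (\<lambda>x. f (Some x)) =
     (\<Sum>x\<in>UNIV. f (Some x)) / real CARD('x)"
    by (simp add: integral_pmf_of_set)
  finally show ?thesis by simp
qed

lemma finite_set_codebook [simp]: "finite (set_pmf (codebook i))"
  unfolding codebook_def by (subst set_Pi_pmf) (auto intro!: finite_PiE_dflt)

lemma finite_set_step_rnd [simp]: "finite (set_pmf (step_rnd i))"
  unfolding step_rnd_def by simp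

lemma finite_set_traj [simp]: "finite (set_pmf (traj W b i))"
  by (induction i) auto

lemma length_traj: "t \<in> set_pmf (traj W b i) \<Longrightarrow> length t = i"
  by (induction i arbitrary: t) auto

text \<open>Supermartingale inequality iterated over \<open>n\<close> uses; it serves both for the
  error potential and for the exponential of regret minus gain.\<close>

lemma traj_expectation_le:
  assumes "\<And>i t. i < n \<Longrightarrow> length t = i \<Longrightarrow>
     measure_pmf.expectation (step_rnd i)
       (\<lambda>s. measure_pmf.expectation (W i (input b t s)) (\<lambda>y. V (t @ [(s, y)]))) \<le> (V t :: real)"
  shows "measure_pmf.expectation (traj W b n) V \<le> V []"
  using assms
proof (induction n)
  case (Suc n)
  have "measure_pmf.expectation (traj W b (Suc n)) V = measure_pmf.expectation (traj W b n)
      (\<lambda>t. measure_pmf.expectation (step_rnd n)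
       (\<lambda>s. measure_pmf.expectation (W n (input b t s)) (\<lambda>y. V (t @ [(s, y)]))))"
    by (simp add: expectation_bind_finite)
  also have "\<dots> \<le> measure_pmf.expectation (traj W b n) V"
    by (intro expectation_mono_finite) (auto intro!: Suc.prems dest: length_traj)
  also have "\<dots> \<le> V []" using Suc by simp
  finally show ?case .
qed simp

lemma expectation_step:
  fixes W :: "'x::finite \<Rightarrow> 'y::finite pmf"
  shows "measure_pmf.expectation (step_rnd i)
       (\<lambda>s. measure_pmf.expectation (W (input b t s)) (\<lambda>y. g s y)) =
    (1 - lam) * measure_pmf.expectation (codebook i)
       (\<lambda>c. \<Sum>y\<in>UNIV. pmf (W (c (hist t, cur b t))) y * g (None, c) y) +
    lam / real CARD('x) * (\<Sum>x\<in>UNIV. \<Sum>y\<in>UNIV. pmf (W x) y *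
       measure_pmf.expectation (codebook i) (\<lambda>c. g (Some x, c) y))"
proof -
  have "measure_pmf.expectation (step_rnd i)
       (\<lambda>s. measure_pmf.expectation (W (input b t s)) (\<lambda>y. g s y)) =
     measure_pmf.expectation pilot_pmf (\<lambda>z. measure_pmf.expectation (codebook i)
       (\<lambda>c. measure_pmf.expectation (W (input b t (z, c))) (\<lambda>y. g (z, c) y)))"
    unfolding step_rnd_def pair_pmf_def by (simp add: expectation_bind_finite)
  also have "\<dots> = (1 - lam) * measure_pmf.expectation (codebook i)
       (\<lambda>c. \<Sum>y\<in>UNIV. pmf (W (c (hist t, cur b t))) y * g (None, c) y) +
    lam / real CARD('x) * (\<Sum>x\<in>UNIV. measure_pmf.expectation (codebook i)
       (\<lambda>c. \<Sum>y\<in>UNIV. pmf (W x) y * g (Some x, c) y))"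
    by (subst expectation_pilot_pmf) (simp add: input_def expectation_finite_UNIV)
  also have "(\<lambda>x. measure_pmf.expectation (codebook i) (\<lambda>c. \<Sum>y\<in>UNIV. pmf (W x) y * g (Some x, c) y)) =
     (\<lambda>x. \<Sum>y\<in>UNIV. pmf (W x) y * measure_pmf.expectation (codebook i) (\<lambda>c. g (Some x, c) y))"
    by (intro ext, subst Bochner_Integration.integral_sum) (auto intro!: integrable_measure_pmf_finite)
  finally show ?thesis .
qed

lemma expectation_codebook:
  fixes f :: "'x::finite \<Rightarrow> real" and h :: "('x \<times> 'y::finite) option list"
  assumes "length h = i" "m \<in> blocks"
  shows "measure_pmf.expectation (codebook i) (\<lambda>c. f (c (h, m))) = (\<Sum>x\<in>UNIV. prior (learn h) x * f x)"
  unfolding codebook_def using assms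
  by (subst expectation_Pi_pmf_component) (auto simp: expectation_finite_UNIV)

text \<open>Letters of distinct blocks are independent, so a wrong candidate's letter is independent
  of the letter that drives the channel.\<close>

lemma expectation_codebook_two:
  fixes f g :: "'x::finite \<Rightarrow> real" and h :: "('x \<times> 'y::finite) option list"
  assumes "length h = i" "m \<in> blocks" "m' \<in> blocks" "m \<noteq> m'" "\<And>x. 0 \<le> f x" "\<And>x. 0 \<le> g x"
  shows "measure_pmf.expectation (codebook i) (\<lambda>c. f (c (h, m)) * g (c (h, m'))) =
     (\<Sum>x\<in>UNIV. prior (learn h) x * f x) * (\<Sum>x\<in>UNIV. prior (learn h) x * g x)"
  unfolding codebook_def using assms
  by (subst expectation_Pi_pmf_two_components) (auto simp: expectation_finite_UNIV)

section \<open>Error probability\<close>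

text \<open>Martingale property of a wrong candidate under any channel: given the output
  \<open>y\<close> its letter still has law \<open>prior\<close>, and the mean of posterior over
  prior is the total mass of the posterior, namely \<open>1\<close>.\<close>

lemma expected_new_metric:
  fixes W :: "'x::finite \<Rightarrow> 'y::finite pmf"
  assumes t: "length t = i" and m: "m \<in> blocks" "m \<noteq> cur b t"
  shows "measure_pmf.expectation (codebook i)
     (\<lambda>c. \<Sum>y\<in>UNIV. pmf (W (c (hist t, cur b t))) y * new_metric t c y m) = metric t m"
proof -
  let ?L = "learn (hist t)"
  have "measure_pmf.expectation (codebook i)
     (\<lambda>c. \<Sum>y\<in>UNIV. pmf (W (c (hist t, cur b t))) y * new_metric t c y m) =
     (\<Sum>y\<in>UNIV. measure_pmf.expectation (codebook i)
     (\<lambda>c. pmf (W (c (hist t, cur b t))) y * (metric t m / ratio ?L (c (hist t, m)) y)))"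
    unfolding new_metric_def
    by (intro Bochner_Integration.integral_sum integrable_measure_pmf_finite) auto
  also have "\<dots> = (\<Sum>y\<in>UNIV. (\<Sum>x\<in>UNIV. prior ?L x * pmf (W x) y) *
      (\<Sum>x\<in>UNIV. prior ?L x * (metric t m / ratio ?L x y)))"
    using t m by (intro sum.cong refl expectation_codebook_two)
      (auto intro!: divide_nonneg_nonneg less_imp_le[OF metric_pos] less_imp_le[OF ratio_pos])
  also have "\<dots> = (\<Sum>y\<in>UNIV. (\<Sum>x\<in>UNIV. prior ?L x * pmf (W x) y) * metric t m)"
  proof (intro sum.cong refl arg_cong2[where f="(*)"])
    fix y
    have "(\<Sum>x\<in>UNIV. prior ?L x * (metric t m / ratio ?L x y)) = (\<Sum>x\<in>UNIV. posterior ?L y x * metric t m)"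
    proof (intro sum.cong refl)
      fix x
      show "prior ?L x * (metric t m / ratio ?L x y) = posterior ?L y x * metric t m"
        using prior_pos[of ?L x] by (simp add: ratio_def)
    qed
    then show "(\<Sum>x\<in>UNIV. prior ?L x * (metric t m / ratio ?L x y)) = metric t m"
      by (simp add: sum_posterior flip: sum_distrib_right)
  qed
  also have "\<dots> = metric t m"
    by (subst sum_distrib_right[symmetric], subst sum.swap)
       (simp add: sum_pmf_eq_1 sum_prior flip: sum_distrib_left)
  finally show ?thesis .
qed

text \<open>Frozen at \<open>thr\<close> from the first error on. A wrong block gets decoded only
  with metric at least \<open>thr\<close>, so freezing does not raise the value above the sum of the
  wrong metrics.\<close>

definition err_pot where
  "err_pot b t = (if err b t then thr else \<Sum>m\<in>blocks - {cur b t}. metric t m)"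

text \<open>If a wrong block is decoded, its metric alone covers \<open>thr\<close>. If the true
  block is decoded, all metrics restart at \<open>1\<close>, and there are \<open>2 ^ K\<close> of
  them. If nothing is decoded, the new potential is the sum itself.\<close>

lemma err_pot_data_le:
  assumes "0 < thr" and "\<not> err b t"
  shows "err_pot b (t @ [((None, c), y)]) \<le> (\<Sum>m\<in>blocks - {cur b t}. new_metric t c y m) + 2 ^ K"
proof -
  have nonneg: "0 \<le> new_metric t c y m" for m
    unfolding new_metric_def by (intro divide_nonneg_nonneg less_imp_le[OF metric_pos] less_imp_le[OF ratio_pos])
  then have sum_nonneg': "0 \<le> (\<Sum>m\<in>blocks - {cur b t}. new_metric t c y m)" by (intro sum_nonneg)
  show ?thesis
  proof (cases rule: decoded_data_cases[of t c y])
    case (decode m)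
    show ?thesis
    proof (cases "m = cur b t")
      case True
      have "\<not> err b (t @ [((None, c), y)])"
        using assms(2) unfolding err_def decode True cur_def by (auto simp: nth_append less_Suc_eq)
      then have "err_pot b (t @ [((None, c), y)]) = real (card (blocks - {cur b (t @ [((None, c), y)])}))"
        by (simp add: err_pot_def decode)
      also have "\<dots> \<le> real (card blocks)"
        by (intro of_nat_mono card_mono) auto
      finally show ?thesis using sum_nonneg' by (simp add: card_blocks)
    next
      case False
      have "err b (t @ [((None, c), y)])"
        using False unfolding err_def decode cur_def by (intro exI[of _ "length (decoded t)"]) auto
      then have "err_pot b (t @ [((None, c), y)]) = thr" by (simp add: err_pot_def)
      also have "\<dots> \<le> new_metric t c y m" by fact
      also have "\<dots> \<le> (\<Sum>m\<in>blocks - {cur b t}. new_metric t c y m)"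
        using False decode nonneg by (intro member_le_sum) auto
      finally show ?thesis by (simp add: add_increasing2)
    qed
  next
    case continue
    have "\<not> err b (t @ [((None, c), y)])"
      using assms(2) unfolding err_def continue .
    then have "err_pot b (t @ [((None, c), y)]) = (\<Sum>m\<in>blocks - {cur b t}. new_metric t c y m)"
      by (simp add: err_pot_def cur_def continue)
    then show ?thesis by simp
  qed
qed

lemma expected_err_pot_step:
  fixes W :: "'x::finite \<Rightarrow> 'y::finite pmf"
  assumes thr: "0 < thr" and t: "length t = i"
  shows "measure_pmf.expectation (step_rnd i) (\<lambda>s. measure_pmf.expectation (W (input b t s))
     (\<lambda>y. err_pot b (t @ [(s, y)]))) \<le> err_pot b t + 2 ^ K"
proof (cases "err b t")
  case True
  \<comment> \<open>An error is permanent because decoded blocks are only ever appended.\<close>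
  have "err_pot b (t @ [(s, y)]) = err_pot b t" for s y
  proof -
    obtain z c where s: "s = (z, c)" by (cases s)
    have "err b (t @ [(s, y)])"
    proof (cases z)
      case None
      show ?thesis using True unfolding s None err_def decoded_data
        by (auto simp: nth_append less_Suc_eq)
    qed (use True s in \<open>simp add: err_def\<close>)
    then show ?thesis using True by (simp add: err_pot_def)
  qed
  then show ?thesis by simp
next
  case False
  have pilot: "err_pot b (t @ [((Some x, c), y)]) = err_pot b t" for x c y
  proof -
    have "err b (t @ [((Some x, c), y)]) = err b t" unfolding err_def by simp
    then show ?thesis by (simp add: err_pot_def cur_def)
  qed
  have "measure_pmf.expectation (codebook i)
       (\<lambda>c. \<Sum>y\<in>UNIV. pmf (W (c (hist t, cur b t))) y * err_pot b (t @ [((None, c), y)])) \<le>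
     measure_pmf.expectation (codebook i)
       (\<lambda>c. (\<Sum>m\<in>blocks - {cur b t}. \<Sum>y\<in>UNIV. pmf (W (c (hist t, cur b t))) y * new_metric t c y m) + 2 ^ K)"
  proof (intro expectation_mono_finite finite_set_codebook)
    fix c
    have "(\<Sum>y\<in>UNIV. pmf (W (c (hist t, cur b t))) y * err_pot b (t @ [((None, c), y)])) \<le>
      (\<Sum>y\<in>UNIV. pmf (W (c (hist t, cur b t))) y * ((\<Sum>m\<in>blocks - {cur b t}. new_metric t c y m) + 2 ^ K))"
      by (intro sum_mono mult_left_mono err_pot_data_le thr False) auto
    also have "\<dots> = (\<Sum>m\<in>blocks - {cur b t}. \<Sum>y\<in>UNIV. pmf (W (c (hist t, cur b t))) y * new_metric t c y m) + 2 ^ K"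
      by (subst sum.swap) (simp add: distrib_left sum.distrib sum_pmf_eq_1 sum_distrib_left flip: sum_distrib_right)
    finally show "(\<Sum>y\<in>UNIV. pmf (W (c (hist t, cur b t))) y * err_pot b (t @ [((None, c), y)])) \<le>
      (\<Sum>m\<in>blocks - {cur b t}. \<Sum>y\<in>UNIV. pmf (W (c (hist t, cur b t))) y * new_metric t c y m) + 2 ^ K" .
  qed
  also have "\<dots> = (\<Sum>m\<in>blocks - {cur b t}. metric t m) + 2 ^ K"
    by (subst expectation_sum_add)
       (auto intro!: sum.cong expected_new_metric[OF t] simp del: Bochner_Integration.integral_sum)
  also have "\<dots> = err_pot b t + 2 ^ K" using False by (simp add: err_pot_def)
  finally have data: "measure_pmf.expectation (codebook i)
       (\<lambda>c. \<Sum>y\<in>UNIV. pmf (W (c (hist t, cur b t))) y * err_pot b (t @ [((None, c), y)])) \<le> err_pot b t + 2 ^ K" .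
  have "measure_pmf.expectation (step_rnd i) (\<lambda>s. measure_pmf.expectation (W (input b t s))
     (\<lambda>y. err_pot b (t @ [(s, y)]))) \<le> (1 - lam) * (err_pot b t + 2 ^ K) + lam * err_pot b t"
    unfolding expectation_step[of i W b t "\<lambda>s y. err_pot b (t @ [(s, y)])"] pilot
    using lam data by (simp add: sum_pmf_eq_1 mult_left_mono flip: sum_distrib_right)
  also have "\<dots> \<le> err_pot b t + 2 ^ K"
    using lam mult_right_mono[of "1 - lam" 1 "2 ^ K :: real"] by (simp add: algebra_simps)
  finally show ?thesis .
qed

text \<open>Markov's inequality: the potential is \<open>thr\<close> after an error, and its mean is
  at most \<open>2 ^ K\<close> at the start plus \<open>2 ^ K\<close> for each use.\<close>

lemma error_prob:
  assumes thr: "0 < thr"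
  shows "measure_pmf.prob (traj W b n) {t. err b t} \<le> (real n + 1) * 2 ^ K / thr"
proof -
  \<comment> \<open>The second term prepays the drift of \<open>2 ^ K\<close> for every remaining
    use, turning the potential into a supermartingale.\<close>
  define V where "V t = err_pot b t + 2 ^ K * (real n - real (length t))"
    for t :: "(('a option \<times> (('a \<times> 'b) option list \<times> bool list \<Rightarrow> 'a)) \<times> 'b) list"
  have pot_nonneg: "0 \<le> err_pot b t" for t :: "(('a option \<times> (('a \<times> 'b) option list \<times> bool list \<Rightarrow> 'a)) \<times> 'b) list"
    unfolding err_pot_def using thr by (auto intro!: sum_nonneg less_imp_le[OF metric_pos])
  have "measure_pmf.expectation (traj W b n) V \<le> V []"
  proof (rule traj_expectation_le)
    fix i and t :: "(('a option \<times> (('a \<times> 'b) option list \<times> bool list \<Rightarrow> 'a)) \<times> 'b) list"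
    assume t: "length t = i"
    have "measure_pmf.expectation (step_rnd i) (\<lambda>s. measure_pmf.expectation (W i (input b t s))
       (\<lambda>y. V (t @ [(s, y)]))) = measure_pmf.expectation (step_rnd i) (\<lambda>s. measure_pmf.expectation (W i (input b t s))
       (\<lambda>y. err_pot b (t @ [(s, y)])) + 2 ^ K * (real n - real i - 1))"
      unfolding V_def by (simp add: t integrable_measure_pmf_finite algebra_simps)
    also have "\<dots> = measure_pmf.expectation (step_rnd i) (\<lambda>s. measure_pmf.expectation (W i (input b t s))
       (\<lambda>y. err_pot b (t @ [(s, y)]))) + 2 ^ K * (real n - real i - 1)"
      by (simp add: integrable_measure_pmf_finite)
    also have "\<dots> \<le> V t"
      using expected_err_pot_step[OF thr t, of "W i" b] by (simp add: V_def t algebra_simps)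
    finally show "measure_pmf.expectation (step_rnd i) (\<lambda>s. measure_pmf.expectation (W i (input b t s))
       (\<lambda>y. V (t @ [(s, y)]))) \<le> V t" .
  qed
  also have "V [] \<le> 2 ^ K * (real n + 1)"
  proof -
    have "err_pot b ([] :: (('a option \<times> (('a \<times> 'b) option list \<times> bool list \<Rightarrow> 'a)) \<times> 'b) list) =
       real (card (blocks - {block b 0}))"
      by (simp add: err_pot_def err_def cur_def)
    also have "\<dots> \<le> real (card blocks)" by (intro of_nat_mono card_mono) auto
    finally show ?thesis by (simp add: V_def card_blocks algebra_simps)
  qed
  finally have V: "measure_pmf.expectation (traj W b n) V \<le> 2 ^ K * (real n + 1)" .
  have "thr * measure_pmf.prob (traj W b n) {t. err b t} =
     measure_pmf.expectation (traj W b n) (\<lambda>t. thr * indicator {t. err b t} t)"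
    by simp
  also have "\<dots> \<le> measure_pmf.expectation (traj W b n) V"
  proof (intro expectation_mono_finite finite_set_traj)
    fix t assume "t \<in> set_pmf (traj W b n)"
    then have "V t = err_pot b t" by (simp add: V_def length_traj)
    moreover have "thr * indicator {t. err b t} t \<le> err_pot b t"
      using pot_nonneg[of t] by (cases "err b t") (auto simp: err_pot_def)
    ultimately show "thr * indicator {t. err b t} t \<le> V t" by simp
  qed
  finally have "thr * measure_pmf.prob (traj W b n) {t. err b t} \<le> 2 ^ K * (real n + 1)"
    using V by linarith
  then show ?thesis using thr by (simp add: field_simps)
qed

end

section \<open>Information gain\<close>

context scheme
begin

definition incr where
  "incr b t e = (case fst (fst e) of Some _ \<Rightarrow> 0
     | None \<Rightarrow> - ln (ratio (learn (hist t)) (snd (fst e) (hist t, cur b t)) (snd e)))"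

text \<open>Total log score of the true message; unlike \<open>metric\<close> it is not reset when a
  block is decoded.\<close>

definition gain where "gain b t = (\<Sum>i<length t. incr b (take i t) (t ! i))"

lemma gain_Nil [simp]: "gain b [] = 0"
  by (simp add: gain_def)

lemma gain_snoc: "gain b (t @ [e]) = gain b t + incr b t e"
proof -
  have "(\<Sum>i<length t. incr b (take i (t @ [e])) ((t @ [e]) ! i)) = gain b t"
    unfolding gain_def by (intro sum.cong refl) (simp add: nth_append)
  then show ?thesis unfolding gain_def by simp
qed

lemma learn_snoc: "learn (h @ [z]) = upd (learn h) z"
  by (simp add: learn_def)

text \<open>Before each data use all metrics are below \<open>thr\<close>, since otherwise a block
  would have been decoded. A finished block thus accounts for at most \<open>ln thr\<close> plus one
  bounded overshoot; the extra \<open>1\<close> is for the unfinished block.\<close>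

lemma gain_le:
  fixes t :: "(('x::finite option \<times> (('x \<times> 'y::finite) option list \<times> bool list \<Rightarrow> 'x)) \<times> 'y) list"
  assumes thr: "1 < thr" and no_err: "\<not> err b t"
  shows "gain b t \<le> (real (length (decoded t)) + 1) * (ln thr + ln (real CARD('x) / bet))"
proof -
  let ?A = "ln (real CARD('x) / bet)"
  have A: "0 \<le> ?A" using card_div_bet_ge[where 'x='x] by simp
  have "gain b t \<le> real (length (decoded t)) * (ln thr + ?A) + ln (metric t (cur b t)) \<and>
     (\<forall>m\<in>blocks. metric t m < thr)"
    using no_err
  proof (induction t rule: rev_induct)
    case (snoc e t)
    obtain z c y where e: "e = ((z, c), y)" by (metis surj_pair)
    show ?case
    proof (cases z)
      case (Some x)
      have "\<not> err b t" using snoc.prems unfolding e Some err_def by simp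
      then show ?thesis using snoc.IH
        unfolding e Some by (simp add: gain_snoc incr_def cur_def)
    next
      case None
      define r where "r = ratio (learn (hist t)) (c (hist t, cur b t)) y"
      have r: "0 < r" "\<bar>ln r\<bar> \<le> ?A" unfolding r_def by (auto intro: ratio_pos ratio_bounds)
      have gain: "gain b (t @ [((None, c), y)]) = gain b t - ln r"
        by (simp add: gain_snoc incr_def r_def)
      have old: "\<not> err b t"
        using snoc.prems unfolding e None err_def decoded_data
        by (auto simp: nth_append less_Suc_eq split: if_splits)
      note IH = snoc.IH[OF old]
      have met: "ln (metric t (cur b t)) < ln thr"
        using IH metric_pos[of t "cur b t"] thr by simp
      show ?thesis unfolding e None
      proof (cases rule: decoded_data_cases[of t c y])
        case (decode m)
        have "real (length (decoded t)) * (ln thr + ?A) + ln (metric t (cur b t)) - ln r \<le>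
           real (Suc (length (decoded t))) * (ln thr + ?A)"
          using met r by (simp add: algebra_simps)
        then show "gain b (t @ [((None, c), y)]) \<le> real (length (decoded (t @ [((None, c), y)]))) * (ln thr + ?A) +
             ln (metric (t @ [((None, c), y)]) (cur b (t @ [((None, c), y)]))) \<and>
             (\<forall>m\<in>blocks. metric (t @ [((None, c), y)]) m < thr)"
          using IH thr unfolding gain decode by simp
      next
        case continue
        have "ln (new_metric t c y (cur b t)) = ln (metric t (cur b t)) - ln r"
          unfolding new_metric_def r_def[symmetric] using r metric_pos[of t "cur b t"] by (simp add: ln_div)
        then show "gain b (t @ [((None, c), y)]) \<le> real (length (decoded (t @ [((None, c), y)]))) * (ln thr + ?A) +
             ln (metric (t @ [((None, c), y)]) (cur b (t @ [((None, c), y)]))) \<and>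
             (\<forall>m\<in>blocks. metric (t @ [((None, c), y)]) m < thr)"
          using IH continue(1) unfolding gain continue cur_def by simp
      qed
    qed
  qed (use thr in simp)
  moreover have "ln (metric t (cur b t)) < ln thr" if "\<forall>m\<in>blocks. metric t m < thr"
    using that metric_pos[of t "cur b t"] thr by simp
  ultimately show ?thesis
    using A by (auto simp: algebra_simps)
qed

text \<open>Markov's inequality for the exponential supermartingale \<open>V\<close> built from
  discounted regret minus gain. The three losses are the initial potential, the accumulated
  second-order errors \<open>v\<close>, and the price of confidence \<open>1 - del\<close>.\<close>

lemma gain_tail:
  fixes W :: "nat \<Rightarrow> 'x::finite \<Rightarrow> 'y::finite pmf"
    and q :: "'x \<Rightarrow> real" and a :: "'y \<Rightarrow> 'x \<Rightarrow> real" and rho del :: real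
  defines "A \<equiv> real CARD('x) / bet" and "D \<equiv> real CARD('x) / lam"
    and "kap \<equiv> (1 - bet) * (1 - lam)"
  defines "B \<equiv> 2 * ln A + 5"
  defines "F \<equiv> (\<lambda>i. \<Sum>x\<in>UNIV. \<Sum>y\<in>UNIV. pmf (W i x) y * (- q x * ln (q x / a y x)))"
  defines "v \<equiv> rho\<^sup>2 * (2 * real CARD('x) * D * B\<^sup>2) + rho * (6 * eta * real CARD('x) * D * A)"
  assumes small: "eta * D * (6 * A) \<le> 1" and rho: "0 < rho" "rho * D * B \<le> 1"
    and q: "\<And>x. 0 \<le> q x" "(\<Sum>x\<in>UNIV. q x) = 1"
    and a: "\<And>y x. bet / real CARD('x) \<le> a y x" "\<And>y. (\<Sum>x\<in>UNIV. a y x) = 1"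
    and del: "0 < del"
  shows "measure_pmf.prob (traj W b n) {t. gain b t < kap * (\<Sum>i<n. F i) -
     ((1 + real CARD('y)) * ln (real CARD('x)) / eta + real n * v / rho + ln (1 / del) / rho)} \<le> del"
    (is "measure_pmf.prob _ ?bad \<le> _")
proof -
  let ?P = "pot q a"
  define V where "V t = exp (rho * (kap * ?P (learn (hist t)) - gain b t) + (\<Sum>i<length t. rho * kap * F i - v))"
    for t :: "(('x option \<times> (('x \<times> 'y) option list \<times> bool list \<Rightarrow> 'x)) \<times> 'y) list"
  have kap: "0 \<le> kap" "kap \<le> 1"
    unfolding kap_def using bet lam by (auto intro!: mult_nonneg_nonneg mult_le_one)
  have a0: "0 \<le> a y x" for y x
    using a(1)[of y x] bet by (smt (verit) divide_nonneg_nonneg of_nat_0_le_iff)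
  have "measure_pmf.expectation (traj W b n) V \<le> V []"
  proof (rule traj_expectation_le)
    fix i and t :: "(('x option \<times> (('x \<times> 'y) option list \<times> bool list \<Rightarrow> 'x)) \<times> 'y) list"
    assume t: "length t = i"
    let ?L = "learn (hist t)"
    define Z where "Z = V t * exp (rho * kap * F i - v)"
    have Z: "0 \<le> Z" by (simp add: Z_def V_def)
    have data: "V (t @ [((None, c), y)]) = Z * exp (rho * ln (ratio ?L (c (hist t, cur b t)) y))" for c y
      by (simp add: V_def Z_def gain_snoc incr_def learn_snoc t algebra_simps flip: exp_add)
    have pilot: "V (t @ [((Some x, c), y)]) = Z * exp (rho * (kap * (?P (upd ?L (Some (x, y))) - ?P ?L)))" for x c y
      unfolding V_def Z_def
      by (simp add: gain_snoc incr_def learn_snoc t algebra_simps del: upd.simps flip: exp_add)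
    have "measure_pmf.expectation (step_rnd i) (\<lambda>s. measure_pmf.expectation (W i (input b t s)) (\<lambda>y. V (t @ [(s, y)]))) =
       (1 - lam) * measure_pmf.expectation (codebook i) (\<lambda>c. \<Sum>y\<in>UNIV. pmf (W i (c (hist t, cur b t))) y *
           (Z * exp (rho * ln (ratio ?L (c (hist t, cur b t)) y)))) +
       lam / real CARD('x) * (\<Sum>x\<in>UNIV. \<Sum>y\<in>UNIV. pmf (W i x) y *
           (Z * exp (rho * (kap * (?P (upd ?L (Some (x, y))) - ?P ?L)))))"
      unfolding expectation_step[of i "W i" b t "\<lambda>s y. V (t @ [(s, y)])"] data pilot by simp
    also have "measure_pmf.expectation (codebook i) (\<lambda>c. \<Sum>y\<in>UNIV. pmf (W i (c (hist t, cur b t))) y *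
           (Z * exp (rho * ln (ratio ?L (c (hist t, cur b t)) y)))) =
        (\<Sum>x\<in>UNIV. prior ?L x * (\<Sum>y\<in>UNIV. pmf (W i x) y * (Z * exp (rho * ln (ratio ?L x y)))))"
      using t by (intro expectation_codebook) auto
    also have "(1 - lam) * \<dots> + lam / real CARD('x) * (\<Sum>x\<in>UNIV. \<Sum>y\<in>UNIV. pmf (W i x) y *
           (Z * exp (rho * (kap * (?P (upd ?L (Some (x, y))) - ?P ?L))))) =
       Z * ((1 - lam) * (\<Sum>x\<in>UNIV. prior ?L x * (\<Sum>y\<in>UNIV. pmf (W i x) y * exp (rho * ln (ratio ?L x y)))) +
        lam / real CARD('x) * (\<Sum>x\<in>UNIV. \<Sum>y\<in>UNIV. pmf (W i x) y *
          exp (rho * (kap * (?P (upd ?L (Some (x, y))) - ?P ?L)))))"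
      by (simp add: distrib_left sum_distrib_left mult_ac)
    also have "\<dots> \<le> Z * exp (- (rho * kap * F i) + v)"
      using step_exp[OF small[unfolded A_def D_def] rho[unfolded B_def A_def D_def] q a, of ?L "W i"] Z
      unfolding A_def D_def B_def kap_def F_def v_def
      by (intro mult_left_mono) (simp_all only: add.assoc)
    also have "\<dots> = V t" by (simp add: Z_def flip: exp_add)
    finally show "measure_pmf.expectation (step_rnd i) (\<lambda>s. measure_pmf.expectation (W i (input b t s)) (\<lambda>y. V (t @ [(s, y)]))) \<le> V t" .
  qed
  also have "V [] = exp (rho * (kap * ((1 + real CARD('y)) * ln (real CARD('x)) / eta)))"
    by (simp add: V_def pot_init)
  also have "\<dots> \<le> exp (rho * ((1 + real CARD('y)) * ln (real CARD('x)) / eta))" (is "_ \<le> ?V0")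
  proof -
    have "0 \<le> ln (real CARD('x))"
      using zero_less_card_finite[where 'a='x] by (intro ln_ge_zero) linarith
    then have "kap * ((1 + real CARD('y)) * ln (real CARD('x)) / eta) \<le> 1 * ((1 + real CARD('y)) * ln (real CARD('x)) / eta)"
      using kap eta by (intro mult_right_mono) auto
    from mult_left_mono[OF this, of rho] show ?thesis
      unfolding exp_le_cancel_iff mult_1 using rho by simp
  qed
  finally have EV: "measure_pmf.expectation (traj W b n) V \<le> ?V0" .
  have "?V0 / del * measure_pmf.prob (traj W b n) ?bad = measure_pmf.expectation (traj W b n) (\<lambda>t. ?V0 / del * indicator ?bad t)"
    by simp
  also have "\<dots> \<le> measure_pmf.expectation (traj W b n) V"
  proof (intro expectation_mono_finite finite_set_traj)
    fix t assume "t \<in> set_pmf (traj W b n)"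
    then have t: "length t = n" by (rule length_traj)
    show "?V0 / del * indicator ?bad t \<le> V t"
    proof (cases "t \<in> ?bad")
      case True
      have p0: "0 \<le> kap * ?P (learn (hist t))"
        using kap by (intro mult_nonneg_nonneg pot_nonneg q a a0)
      have "?V0 / del = exp (rho * ((1 + real CARD('y)) * ln (real CARD('x)) / eta) + ln (1 / del))"
        using del by (simp add: exp_add)
      also have "\<dots> = exp (rho * ((1 + real CARD('y)) * ln (real CARD('x)) / eta + real n * v / rho + ln (1 / del) / rho) - real n * v)"
        using rho by (simp add: distrib_left)
      also have "\<dots> \<le> exp (rho * (kap * (\<Sum>i<n. F i) - gain b t) - real n * v)"
        using True rho by simp
      also have "\<dots> \<le> exp (rho * (kap * (\<Sum>i<n. F i) + (kap * ?P (learn (hist t)) - gain b t)) - real n * v)"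
        using p0 rho by simp
      also have "\<dots> = V t"
        by (simp add: V_def t sum_subtractf sum_distrib_left algebra_simps)
      finally show ?thesis using True by simp
    qed (simp add: V_def)
  qed
  finally have "?V0 / del * measure_pmf.prob (traj W b n) ?bad \<le> ?V0" using EV by linarith
  then show ?thesis using del by (simp add: field_simps)
qed

end

section \<open>From finite randomness to rate-adaptive systems\<close>

text \<open>Law of the output sequence generated by causal kernels; its weights are the products in
  \<open>out_prob\<close>.\<close>

primrec outputs :: "(nat \<Rightarrow> 'y list \<Rightarrow> 'y pmf) \<Rightarrow> nat \<Rightarrow> 'y list pmf" where
  "outputs k 0 = return_pmf []"
| "outputs k (Suc n) = bind_pmf (outputs k n) (\<lambda>ys. map_pmf (\<lambda>y. ys @ [y]) (k n ys))"

lemma length_outputs: "ys \<in> set_pmf (outputs k n) \<Longrightarrow> length ys = n"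
  by (induction n arbitrary: ys) auto

lemma finite_set_outputs [simp]: "finite (set_pmf (outputs k n :: 'y::finite list pmf))"
  by (induction n) auto

lemma pmf_outputs:
  assumes "length ys = n"
  shows "pmf (outputs k n) ys = (\<Prod>i<n. pmf (k i (take i ys)) (ys ! i))"
  using assms
proof (induction n arbitrary: ys)
  case (Suc n)
  then obtain zs z where ys: "ys = zs @ [z]" "length zs = n"
    by (metis length_Suc_conv_rev)
  have "pmf (map_pmf (\<lambda>y. xs @ [y]) (k n xs)) (zs @ [z]) = indicator {zs} xs * pmf (k n zs) z" for xs
  proof (cases "xs = zs")
    case True
    have "pmf (map_pmf (\<lambda>y. zs @ [y]) (k n zs)) ((\<lambda>y. zs @ [y]) z) = pmf (k n zs) z"
      by (intro pmf_map_inj') (auto simp: inj_def)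
    then show ?thesis using True by simp
  next
    case False
    then have "zs @ [z] \<notin> set_pmf (map_pmf (\<lambda>y. xs @ [y]) (k n xs))" by auto
    then show ?thesis using False by (simp add: pmf_eq_0_set_pmf)
  qed
  then have "pmf (outputs k (Suc n)) ys = pmf (outputs k n) zs * pmf (k n zs) z"
    by (simp add: ys pmf_bind measure_pmf_single)
  also have "\<dots> = (\<Prod>i<n. pmf (k i (take i ys)) (ys ! i)) * pmf (k n zs) z"
    using Suc.IH[OF ys(2)] by (simp add: ys nth_append)
  also have "\<dots> = (\<Prod>i<Suc n. pmf (k i (take i ys)) (ys ! i))"
    by (simp add: ys(1) flip: ys(2))
  finally show ?case .
qed simp

lemma sum_out_prob:
  fixes W :: "nat \<Rightarrow> 'x \<Rightarrow> 'y::finite pmf"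
  shows "(\<Sum>ys\<in>{ys. length ys = n}. out_prob n W f b s ys * indicator {ys. E ys} ys) =
    measure_pmf.prob (outputs (\<lambda>i ys. W i (f i b ys s)) n) {ys. E ys}"
proof -
  let ?O = "outputs (\<lambda>i ys. W i (f i b ys s)) n"
  have fin: "finite {ys :: 'y list. length ys = n}"
    using finite_lists_length_eq[of "UNIV :: 'y set" n] by simp
  have "measure_pmf.prob ?O {ys. E ys} = measure_pmf.expectation ?O (indicator {ys. E ys})"
    by simp
  also have "\<dots> = (\<Sum>ys\<in>{ys. length ys = n}. pmf ?O ys * indicator {ys. E ys} ys)"
    using fin by (subst integral_measure_pmf[of "{ys. length ys = n}"]) (auto dest: length_outputs)
  also have "\<dots> = (\<Sum>ys\<in>{ys. length ys = n}. out_prob n W f b s ys * indicator {ys. E ys} ys)"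
    by (intro sum.cong refl) (simp add: pmf_outputs out_prob_def)
  finally show ?thesis ..
qed

lemma prob_space_bits_M: "prob_space bits_M"
  unfolding bits_M_def by (intro prob_space_PiM measure_pmf.prob_space_axioms)

lemma space_bits_M [simp]: "space bits_M = UNIV"
  by (simp add: bits_M_def space_PiM)

lemma measurable_bit [measurable]: "(\<lambda>b. b j) \<in> bits_M \<rightarrow>\<^sub>M count_space UNIV"
proof -
  have "(\<lambda>b. b j) \<in> bits_M \<rightarrow>\<^sub>M measure_pmf (bernoulli_pmf (1/2))"
    unfolding bits_M_def by (rule measurable_component_singleton) simp
  then show ?thesis by simp
qed

text \<open>A bit string of length \<open>L\<close> paired with a natural number takes countably
  many values, so preimages of points suffice, and any map out of this discrete space is
  measurable.\<close>

lemma measurable_finite_bits: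
  fixes h :: "'r \<Rightarrow> nat" and H :: "bool list \<Rightarrow> nat \<Rightarrow> 'z"
  assumes h: "h \<in> M \<rightarrow>\<^sub>M count_space UNIV"
  shows "(\<lambda>bs. H (map (fst bs) [0..<L]) (h (snd bs))) \<in> bits_M \<Otimes>\<^sub>M M \<rightarrow>\<^sub>M count_space UNIV"
proof -
  have "(\<lambda>bs. (map (fst bs) [0..<L], h (snd bs))) \<in> bits_M \<Otimes>\<^sub>M M \<rightarrow>\<^sub>M count_space (UNIV :: (bool list \<times> nat) set)"
    unfolding measurable_count_space_eq2_countable
  proof (intro conjI ballI)
    fix lk :: "bool list \<times> nat"
    obtain l k where lk: "lk = (l, k)" by (cases lk)
    have [measurable]: "h \<in> M \<rightarrow>\<^sub>M count_space UNIV" by fact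
    have eq: "map b [0..<L] = l \<longleftrightarrow> length l = L \<and> (\<forall>j\<in>{..<L}. b j = l ! j)" for b
    proof
      assume "length l = L \<and> (\<forall>j\<in>{..<L}. b j = l ! j)"
      then show "map b [0..<L] = l" by (intro nth_equalityI) simp_all
    qed (erule subst, simp)
    have "(\<lambda>bs. (map (fst bs) [0..<L], h (snd bs))) -` {lk} \<inter> space (bits_M \<Otimes>\<^sub>M M) =
       {bs \<in> space (bits_M \<Otimes>\<^sub>M M). length l = L \<and> (\<forall>j\<in>{..<L}. fst bs j = l ! j) \<and> h (snd bs) = k}"
      unfolding lk by (intro set_eqI) (simp add: eq, blast)
    also have "\<dots> \<in> sets (bits_M \<Otimes>\<^sub>M M)" by measurable
    finally show "(\<lambda>bs. (map (fst bs) [0..<L], h (snd bs))) -` {lk} \<inter> space (bits_M \<Otimes>\<^sub>M M) \<in> sets (bits_M \<Otimes>\<^sub>M M)" .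
  qed simp
  from measurable_compose[OF this, of "\<lambda>(l, k). H l k" "count_space UNIV"] show ?thesis by simp
qed

text \<open>
  A finitely supported randomness of any type is coded by natural numbers, so that the law of
  \<open>S\<close> may live on the discrete \<open>\<sigma>\<close>-algebra of the reals.  The hypothesis that
  encoders read only finitely many bits makes them measurable.
\<close>

lemma ra_system_of_finite_randomness:
  fixes p :: "'s pmf" and F :: "nat \<Rightarrow> (nat \<Rightarrow> bool) \<Rightarrow> 'y::finite list \<Rightarrow> 's \<Rightarrow> 'x"
    and n L :: nat
    and G :: "'y list \<Rightarrow> 's \<Rightarrow> real" and dec0 :: "'y list \<Rightarrow> 's \<Rightarrow> nat \<Rightarrow> bool"
  defines "J \<equiv> (\<lambda>W b. bind_pmf p (\<lambda>s. map_pmf (Pair s) (outputs (\<lambda>i ys. W i (F i b ys s)) n)))"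
  assumes fin: "finite (set_pmf p)" and G: "\<And>ys s. 0 \<le> G ys s"
    and F: "\<And>i b b' ys s. i < n \<Longrightarrow> (\<And>j. j < L \<Longrightarrow> b j = b' j) \<Longrightarrow> F i b ys s = F i b' ys s"
  shows "\<exists>MSr f g dec. ra_system n MSr f g dec \<and>
    (\<forall>W e. (\<forall>b. measure_pmf.prob (J W b)
        {(s, ys). decoding_error n (\<lambda>ys _. G ys s) (\<lambda>ys _. dec0 ys s) b 0 ys} \<le> e) \<longrightarrow>
       sys_prob n W MSr f (decoding_error n g dec) \<le> e) \<and>
    (\<forall>W c e. (\<forall>b. e \<le> measure_pmf.prob (J W b) {(s, ys). c \<le> G ys s}) \<longrightarrow>
       e \<le> sys_prob n W MSr f (\<lambda>b s ys. c \<le> g ys s))"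
proof -
  obtain enc :: "'s \<Rightarrow> nat" where enc: "inj_on enc (set_pmf p)"
    using finite_imp_inj_to_nat_seg[OF fin] by blast
  \<comment> \<open>Inverts the coding on its support; other reals receive arbitrary values but have
    probability zero.\<close>
  define dn where "dn r = inv_into (set_pmf p) enc (nat \<lfloor>r :: real\<rfloor>)" for r
  have dn: "dn (real (enc s)) = s" if "s \<in> set_pmf p" for s
    using enc that by (simp add: dn_def)
  define MSr where "MSr = measure_pmf (map_pmf (\<lambda>s. real (enc s)) p)"
  define f where "f i b ys r = F i b ys (dn r)" for i b ys r
  define g where "g ys r = G ys (dn r)" for ys r
  define dec where "dec ys r = dec0 ys (dn r)" for ys r
  have MSr_meas: "h \<in> MSr \<rightarrow>\<^sub>M count_space UNIV" for h :: "real \<Rightarrow> 'z"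
    by (simp add: MSr_def)
  have f_meas: "(\<lambda>bs. f i (fst bs) ys (snd bs)) \<in> bits_M \<Otimes>\<^sub>M MSr \<rightarrow>\<^sub>M count_space UNIV" if "i < n" for i ys
  proof -
    \<comment> \<open>The full bit sequence is replaced by its first \<open>L\<close> bits; the
      out-of-range values of \<open>l ! j\<close> do not matter, as \<open>F\<close> depends on bits
      below \<open>L\<close> only.\<close>
    have "(\<lambda>bs. f i (fst bs) ys (snd bs)) =
      (\<lambda>bs. (\<lambda>l k. F i (\<lambda>j. l ! j) ys (inv_into (set_pmf p) enc k)) (map (fst bs) [0..<L]) (nat \<lfloor>snd bs\<rfloor>))"
      unfolding f_def dn_def by (intro ext F that) simp
    also have "\<dots> \<in> bits_M \<Otimes>\<^sub>M MSr \<rightarrow>\<^sub>M count_space UNIV"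
      by (intro measurable_finite_bits MSr_meas)
    finally show ?thesis .
  qed
  interpret bits: prob_space bits_M by (rule prob_space_bits_M)
  interpret MSr: prob_space MSr unfolding MSr_def by (rule measure_pmf.prob_space_axioms)
  interpret pair_prob_space bits_M MSr ..
  \<comment> \<open>Fubini: \<open>sys_prob\<close> is the average over the message of the
    probability for a fixed message, so bounds that hold for every \<open>b\<close> carry
    over.\<close>
  have key: "integrable bits_M (\<lambda>b. measure_pmf.prob (J W b) {(s, ys). E b (real (enc s)) ys}) \<and>
      sys_prob n W MSr f E = (\<integral>b. measure_pmf.prob (J W b) {(s, ys). E b (real (enc s)) ys} \<partial>bits_M)"
    if E: "\<And>ys. Measurable.pred (bits_M \<Otimes>\<^sub>M MSr) (\<lambda>bs. E (fst bs) (snd bs) ys)" for W E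
  proof -
    define Phi where "Phi bs = (\<Sum>ys\<in>{ys. length ys = n}. out_prob n W f (fst bs) (snd bs) ys *
        indicator {ys. E (fst bs) (snd bs) ys} ys)" for bs
    have Phi_prob: "Phi bs = measure_pmf.prob (outputs (\<lambda>i ys. W i (f i (fst bs) ys (snd bs))) n)
       {ys. E (fst bs) (snd bs) ys}" for bs
      unfolding Phi_def by (rule sum_out_prob)
    have ind: "(\<lambda>bs. indicator {ys. E (fst bs) (snd bs) ys} ys :: real) \<in> borel_measurable (bits_M \<Otimes>\<^sub>M MSr)" for ys
    proof -
      have "(\<lambda>bs. indicator {ys. E (fst bs) (snd bs) ys} ys :: real) =
        (\<lambda>bs. if E (fst bs) (snd bs) ys then 1 else 0)" by (auto simp: indicator_def)
      also have "\<dots> \<in> borel_measurable (bits_M \<Otimes>\<^sub>M MSr)"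
        using E[of ys] by (intro measurable_If) auto
      finally show ?thesis .
    qed
    have "(\<lambda>bs. pmf (W i (f i (fst bs) (take i ys) (snd bs))) (ys ! i)) \<in> borel_measurable (bits_M \<Otimes>\<^sub>M MSr)"
      if "i < n" for i and ys :: "'y list"
      by (rule measurable_compose[OF f_meas[OF that], of "\<lambda>x. pmf (W i x) (ys ! i)"]) simp
    then have Phi_meas: "Phi \<in> borel_measurable (bits_M \<Otimes>\<^sub>M MSr)"
      unfolding Phi_def out_prob_def
      by (intro borel_measurable_sum borel_measurable_times borel_measurable_prod ind) auto
    have Phi_int: "integrable (bits_M \<Otimes>\<^sub>M MSr) Phi"
      by (rule P.integrable_const_bound[where B = 1]) (auto simp: Phi_prob Phi_meas)
    have inner: "(\<integral>r. Phi (b, r) \<partial>MSr) = measure_pmf.prob (J W b) {(s, ys). E b (real (enc s)) ys}" for b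
    proof -
      have "(\<integral>r. Phi (b, r) \<partial>MSr) = measure_pmf.expectation p (\<lambda>s. Phi (b, real (enc s)))"
        by (simp add: MSr_def)
      also have "\<dots> = measure_pmf.expectation p (\<lambda>s. measure_pmf.prob
         (outputs (\<lambda>i ys. W i (F i b ys s)) n) {ys. E b (real (enc s)) ys})"
        by (intro integral_cong_AE AE_pmfI) (auto simp: Phi_prob f_def dn)
      also have "\<dots> = measure_pmf.expectation p (\<lambda>s. measure_pmf.expectation
         (map_pmf (Pair s) (outputs (\<lambda>i ys. W i (F i b ys s)) n)) (indicator {(s, ys). E b (real (enc s)) ys}))"
        by (simp add: vimage_def)
      also have "\<dots> = measure_pmf.expectation (J W b) (indicator {(s, ys). E b (real (enc s)) ys})"
        unfolding J_def using fin by (intro expectation_bind_finite[symmetric]) auto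
      finally show ?thesis by simp
    qed
    have "sys_prob n W MSr f E = (\<integral>bs. Phi bs \<partial>(bits_M \<Otimes>\<^sub>M MSr))"
      by (simp add: sys_prob_def Phi_def)
    also have "\<dots> = (\<integral>b. \<integral>r. Phi (b, r) \<partial>MSr \<partial>bits_M)"
      by (rule integral_fst'[OF Phi_int, symmetric])
    finally show ?thesis using integrable_fst'[OF Phi_int] by (simp add: inner)
  qed
  show ?thesis
  proof (intro exI conjI allI impI)
    show "ra_system n MSr f g dec"
      unfolding ra_system_def using f_meas G MSr.prob_space_axioms
      by (auto simp: g_def MSr_def)
  next
    fix W e
    assume e: "\<forall>b. measure_pmf.prob (J W b) {(s, ys). decoding_error n (\<lambda>ys _. G ys s) (\<lambda>ys _. dec0 ys s) b 0 ys} \<le> e"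
    have pred: "Measurable.pred (bits_M \<Otimes>\<^sub>M MSr) (\<lambda>bs. decoding_error n g dec (fst bs) (snd bs) ys)" for ys
    proof -
      have [measurable]: "(\<lambda>r. nat \<lceil>real n * g ys r\<rceil>) \<in> MSr \<rightarrow>\<^sub>M count_space UNIV"
        "\<And>j. (\<lambda>r. dec ys r j) \<in> MSr \<rightarrow>\<^sub>M count_space UNIV" by (rule MSr_meas)+
      show ?thesis unfolding decoding_error_def by measurable
    qed
    have "measure_pmf.prob (J W b) {(s, ys). decoding_error n g dec b (real (enc s)) ys} \<le> e" for b
    proof -
      have "measure_pmf.prob (J W b) {(s, ys). decoding_error n g dec b (real (enc s)) ys} =
        measure_pmf.prob (J W b) {(s, ys). decoding_error n (\<lambda>ys _. G ys s) (\<lambda>ys _. dec0 ys s) b 0 ys}"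
        by (intro measure_pmf.finite_measure_eq_AE AE_pmfI)
           (auto simp: J_def decoding_error_def g_def dec_def dn)
      then show ?thesis using e by simp
    qed
    with key[of "decoding_error n g dec" W, OF pred]
    show "sys_prob n W MSr f (decoding_error n g dec) \<le> e"
      by (auto intro!: bits.integral_le_const)
  next
    fix W c e
    assume e: "\<forall>b. e \<le> measure_pmf.prob (J W b) {(s, ys). c \<le> G ys s}"
    have pred: "Measurable.pred (bits_M \<Otimes>\<^sub>M MSr) (\<lambda>bs. c \<le> g ys (snd bs))" for ys
    proof -
      have [measurable]: "(\<lambda>r. c \<le> g ys r) \<in> MSr \<rightarrow>\<^sub>M count_space UNIV" by (rule MSr_meas)
      show ?thesis by measurable
    qed
    have "e \<le> measure_pmf.prob (J W b) {(s, ys). c \<le> g ys (real (enc s))}" for b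
    proof -
      have "measure_pmf.prob (J W b) {(s, ys). c \<le> g ys (real (enc s))} =
        measure_pmf.prob (J W b) {(s, ys). c \<le> G ys s}"
        by (intro measure_pmf.finite_measure_eq_AE AE_pmfI) (auto simp: J_def g_def dn)
      then show ?thesis using e by simp
    qed
    with key[of "\<lambda>b s ys. c \<le> g ys s" W, OF pred]
    show "e \<le> sys_prob n W MSr f (\<lambda>b s ys. c \<le> g ys s)"
      by (auto intro!: bits.integral_ge_const)
  qed
qed

context scheme
begin

section \<open>Common randomness drawn in advance\<close>

primrec rnd_list ::
  "nat \<Rightarrow> ('x::finite option \<times> (('x \<times> 'y::finite) option list \<times> bool list \<Rightarrow> 'x)) list pmf" where
  "rnd_list 0 = return_pmf []"
| "rnd_list (Suc n) = bind_pmf (rnd_list n) (\<lambda>ss. map_pmf (\<lambda>s. ss @ [s]) (step_rnd n))"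

lemma length_rnd_list: "ss \<in> set_pmf (rnd_list n) \<Longrightarrow> length ss = n"
  by (induction n arbitrary: ss) auto

lemma finite_set_rnd_list [simp]: "finite (set_pmf (rnd_list n))"
  by (induction n) auto

definition encoder where
  "encoder i b ys ss = input b (zip (take i ss) ys) (ss ! i)"

lemma outputs_cong:
  assumes "\<And>i ys. i < n \<Longrightarrow> length ys = i \<Longrightarrow> k i ys = k' i ys"
  shows "outputs k n = outputs k' n"
  using assms by (induction n) (auto intro!: bind_pmf_cong dest: length_outputs)

text \<open>The randomness of use \<open>n\<close> is independent of the past and is not read by
  earlier encoders (\<open>old\<close>), so drawing it commutes with generating the earlier
  outputs.\<close>

lemma traj_eq_bind_rnd_list:
  fixes W :: "nat \<Rightarrow> 'x::finite \<Rightarrow> 'y::finite pmf"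
  shows "traj W b n = bind_pmf (rnd_list n)
     (\<lambda>ss. map_pmf (zip ss) (outputs (\<lambda>i ys. W i (encoder i b ys ss)) n))"
proof (induction n)
  case (Suc n)
  let ?k = "\<lambda>(ss :: ('x option \<times> (('x \<times> 'y) option list \<times> bool list \<Rightarrow> 'x)) list) i ys. W i (encoder i b ys ss)"
  have old: "outputs (?k (ss @ [s])) n = outputs (?k ss) n" if "length ss = n" for ss s
    using that by (intro outputs_cong) (simp add: encoder_def nth_append)
  have "bind_pmf (rnd_list (Suc n)) (\<lambda>ss. map_pmf (zip ss) (outputs (?k ss) (Suc n))) =
    bind_pmf (rnd_list n) (\<lambda>ss. bind_pmf (step_rnd n) (\<lambda>s. bind_pmf (outputs (?k (ss @ [s])) n)
      (\<lambda>ys. map_pmf (\<lambda>y. zip (ss @ [s]) (ys @ [y])) (?k (ss @ [s]) n ys))))"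
    by (simp add: bind_assoc_pmf bind_map_pmf map_bind_pmf pmf.map_comp o_def)
  also have "\<dots> = bind_pmf (rnd_list n) (\<lambda>ss. bind_pmf (step_rnd n) (\<lambda>s. bind_pmf (outputs (?k ss) n)
      (\<lambda>ys. map_pmf (\<lambda>y. zip ss ys @ [(s, y)]) (W n (input b (zip ss ys) s)))))"
  proof (intro bind_pmf_cong refl)
    fix ss s and ys :: "'y list"
    assume "ss \<in> set_pmf (rnd_list n :: ('x option \<times> (('x \<times> 'y) option list \<times> bool list \<Rightarrow> 'x)) list pmf)"
    then have ss: "length ss = n" by (rule length_rnd_list)
    show "outputs (?k (ss @ [s])) n = outputs (?k ss) n" by (rule old[OF ss])
    assume "ys \<in> set_pmf (outputs (?k ss) n)"
    then have "length ys = n" by (rule length_outputs)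
    then show "map_pmf (\<lambda>y. zip (ss @ [s]) (ys @ [y])) (?k (ss @ [s]) n ys) =
        map_pmf (\<lambda>y. zip ss ys @ [(s, y)]) (W n (input b (zip ss ys) s))"
      using ss by (simp add: encoder_def nth_append)
  qed
  also have "\<dots> = bind_pmf (rnd_list n) (\<lambda>ss. bind_pmf (outputs (?k ss) n) (\<lambda>ys. bind_pmf (step_rnd n)
      (\<lambda>s. map_pmf (\<lambda>y. zip ss ys @ [(s, y)]) (W n (input b (zip ss ys) s)))))"
    by (subst bind_commute_pmf) (rule refl)
  also have "\<dots> = traj W b (Suc n)"
    by (simp add: Suc.IH bind_assoc_pmf bind_map_pmf)
  finally show ?case ..
qed simp

text \<open>At most \<open>i\<close> blocks are decoded before use \<open>i\<close>, so the block
  being sent lies within the first \<open>n * K\<close> bits.\<close>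

lemma encoder_finite_bits:
  assumes "i < n" "\<And>j. j < n * K \<Longrightarrow> b j = b' j"
  shows "encoder i b ys ss = encoder i b' ys ss"
proof -
  let ?t = "zip (take i ss) ys"
  have "length (decoded ?t) \<le> i" using length_decoded_le[of ?t] by simp
  then have "Suc (length (decoded ?t)) * K \<le> n * K" using assms(1) by (intro mult_right_mono) auto
  then have "cur b ?t = cur b' ?t"
    unfolding cur_def block_def by (intro map_cong refl assms(2)) auto
  then show ?thesis by (simp add: encoder_def input_def split: option.split)
qed

end

section \<open>Asymptotics of the loss\<close>

text \<open>Every term on the left is of order at most \<open>x powr (-1/4)\<close>, while the right
  side carries an additional factor \<open>sqrt (ln x)\<close>; hence the constants
  \<open>d\<close>, \<open>c\<close>, \<open>e\<close> and \<open>l\<close> are absorbed for large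
  \<open>x\<close>.\<close>

lemma loss_eventually_small:
  fixes d c e l :: real
  assumes "0 < d" "0 < e"
  defines "B \<equiv> (\<lambda>x. 2 * ln (d / x powr (-1/4)) + 5)"
  defines "S \<equiv> (\<lambda>x. c / x powr (-3/4) +
     (x powr (-5/8) * (2 * d * (d / x powr (-1/4)) * (B x)\<^sup>2) +
      6 * x powr (-3/4) * d * (d / x powr (-1/4)) * (d / x powr (-1/4))) * x + l / x powr (-5/8))"
  shows "eventually (\<lambda>x::real. (2 * (2 * d * x powr (-1/4) * x + 2 * x powr (-1/4) * x + S x + (sqrt x + 1) +
     (2 * d * sqrt x + 1) * (ln ((x + 1) / e) + ln (d / x powr (-1/4)))) + 1) / x \<le> ((ln x)\<^sup>2 / x) powr (1/4)) at_top"
  unfolding S_def B_def using assms(1,2) by real_asymp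

text \<open>The side conditions of the scheme: the bound on \<open>bet\<close>, and step sizes
  \<open>eta\<close> and \<open>rho\<close> small enough for the quadratic estimate of
  \<open>exp\<close>.\<close>

lemma params_eventually:
  fixes d :: real
  assumes "0 < d"
  shows "eventually (\<lambda>x::real. x powr (-1/4) \<le> 1/2) at_top"
   "eventually (\<lambda>x::real. x powr (-3/4) * (d / x powr (-1/4)) * (6 * (d / x powr (-1/4))) \<le> 1) at_top"
   "eventually (\<lambda>x::real. x powr (-5/8) * (d / x powr (-1/4)) * (2 * ln (d / x powr (-1/4)) + 5) \<le> 1) at_top"
  using assms by real_asymp+

section \<open>The averaged channel\<close>

lemma pmf_avg_channel:
  assumes "0 < n"
  shows "pmf (avg_channel n W x) y = (\<Sum>i<n. pmf (W i x) y) / real n"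
  using assms unfolding avg_channel_def pmf_bind
  by (subst integral_pmf_of_set) auto

lemma sum_avg_channel:
  fixes W :: "nat \<Rightarrow> 'x::finite \<Rightarrow> 'y::finite pmf"
  assumes "0 < n"
  shows "(\<Sum>i<n. \<Sum>x\<in>UNIV. \<Sum>y\<in>UNIV. pmf (W i x) y * g x y) =
    real n * (\<Sum>x\<in>UNIV. \<Sum>y\<in>UNIV. pmf (avg_channel n W x) y * g x y)"
proof -
  have "(\<Sum>i<n. \<Sum>x\<in>UNIV. \<Sum>y\<in>UNIV. pmf (W i x) y * g x y) =
    (\<Sum>x\<in>UNIV. \<Sum>y\<in>UNIV. \<Sum>i<n. pmf (W i x) y * g x y)"
    by (subst sum.swap) (intro sum.cong refl sum.swap)
  also have "\<dots> = (\<Sum>x\<in>UNIV. \<Sum>y\<in>UNIV. real n * (pmf (avg_channel n W x) y * g x y))"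
    using assms by (simp add: pmf_avg_channel sum_distrib_right)
  finally show ?thesis by (simp add: sum_distrib_left)
qed

lemma pmf_bind_finite:
  fixes Q :: "'x::finite pmf"
  shows "pmf (bind_pmf Q V) y = (\<Sum>x\<in>UNIV. pmf Q x * pmf (V x) y)"
  by (simp add: pmf_bind expectation_finite_UNIV)

lemma mutual_info_nats:
  "ln 2 * mutual_info Q V = (\<Sum>x\<in>UNIV. \<Sum>y\<in>UNIV. if pmf Q x * pmf (V x) y = 0 then 0
     else pmf Q x * pmf (V x) y * ln (pmf (V x) y / pmf (bind_pmf Q V) y))"
  unfolding mutual_info_def sum_distrib_left by (intro sum.cong refl) (simp add: log_def)

lemma pmf_times_le_pmf_bind:
  fixes Q :: "'x::finite pmf"
  shows "pmf Q x * pmf (V x) y \<le> pmf (bind_pmf Q V) y"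
  unfolding pmf_bind_finite by (rule member_le_sum) auto

text \<open>Since \<open>?q * ?w \<le> ?o\<close>, each summand is at most
  \<open>?w * (- ?q * ln ?q) \<le> ?w\<close>. This crude bound serves to estimate the loss from
  \<open>kap\<close> and the number of decoded blocks.\<close>

lemma mutual_info_le_card:
  fixes Q :: "'x::finite pmf" and V :: "'x \<Rightarrow> 'y::finite pmf"
  shows "ln 2 * mutual_info Q V \<le> real CARD('x)"
proof -
  have "ln 2 * mutual_info Q V \<le> (\<Sum>x\<in>UNIV. \<Sum>y\<in>UNIV. pmf (V x) y)"
    unfolding mutual_info_nats
  proof (intro sum_mono)
    fix x and y
    let ?q = "pmf Q x" and ?w = "pmf (V x) y" and ?o = "pmf (bind_pmf Q V) y"
    show "(if ?q * ?w = 0 then 0 else ?q * ?w * ln (?w / ?o)) \<le> ?w"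
    proof (cases "?q * ?w = 0")
      case False
      then have pos: "0 < ?q" "0 < ?w" by (simp_all add: less_le)
      have o: "?q * ?w \<le> ?o" by (rule pmf_times_le_pmf_bind)
      then have opos: "0 < ?o" using mult_pos_pos[OF pos] by linarith
      have "?w / ?o \<le> 1 / ?q" using o opos pos by (simp add: field_simps)
      then have "ln (?w / ?o) \<le> ln (1 / ?q)" using pos opos by simp
      from mult_left_mono[OF this, of ?q] have "?q * ln (?w / ?o) \<le> - ?q * ln ?q"
        using pos by (simp add: ln_div[of 1 ?q])
      also have "\<dots> \<le> 1" by (intro neg_xlnx_bounds pmf_nonneg pmf_le_1)
      finally have "?w * (?q * ln (?w / ?o)) \<le> ?w * 1" using pos by (intro mult_left_mono) auto
      then show ?thesis using False by (simp add: mult_ac)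
    qed simp
  qed
  then show ?thesis by (simp add: sum_pmf_eq_1)
qed

text \<open>The smoothed posterior of the averaged channel is the comparator of the learner.\<close>

lemma smoothed_posterior:
  fixes Q :: "'x::finite pmf" and V :: "'x \<Rightarrow> 'y::finite pmf"
  assumes bet: "0 < bet" "bet \<le> 1/2"
  obtains a :: "'y \<Rightarrow> 'x \<Rightarrow> real" where
    "\<And>y x. bet / real CARD('x) \<le> a y x" "\<And>y. (\<Sum>x\<in>UNIV. a y x) = 1"
    "ln 2 * mutual_info Q V + ln (1 - bet) \<le>
      (\<Sum>x\<in>UNIV. \<Sum>y\<in>UNIV. pmf (V x) y * (- pmf Q x * ln (pmf Q x / a y x)))"
proof -
  define ou where "ou y = pmf (bind_pmf Q V) y" for y
  \<comment> \<open>Bayes posterior of the input; at outputs of probability zero it defaults to the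
    uniform law so as to remain a distribution.\<close>
  define p where "p y x = (if ou y = 0 then 1 / real CARD('x) else pmf Q x * pmf (V x) y / ou y)" for y x
  \<comment> \<open>Mixing with the uniform law bounds \<open>a\<close> from below and costs at most
    a factor \<open>1 - bet\<close>, whence the term \<open>ln (1 - bet)\<close>.\<close>
  define a where "a y x = (1 - bet) * p y x + bet / real CARD('x)" for y x
  have ou0: "0 \<le> ou y" for y by (simp add: ou_def)
  have p0: "0 \<le> p y x" for y x using ou0[of y] by (simp add: p_def)
  have psum: "(\<Sum>x\<in>UNIV. p y x) = 1" for y
  proof (cases "ou y = 0")
    case False
    have "(\<Sum>x\<in>UNIV. p y x) = (\<Sum>x\<in>UNIV. pmf Q x * pmf (V x) y) / ou y"
      using False by (simp add: p_def sum_divide_distrib)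
    also have "(\<Sum>x\<in>UNIV. pmf Q x * pmf (V x) y) = ou y" by (simp add: ou_def pmf_bind_finite)
    finally show ?thesis using False by simp
  qed (simp add: p_def)
  show ?thesis
  proof (rule that[of a])
    show "bet / real CARD('x) \<le> a y x" for y x
      using p0[of y x] bet by (simp add: a_def)
    show "(\<Sum>x\<in>UNIV. a y x) = 1" for y
      using psum[of y] by (simp add: a_def sum.distrib flip: sum_distrib_left)
    have "ln 2 * mutual_info Q V + ln (1 - bet) =
      (\<Sum>x\<in>UNIV. \<Sum>y\<in>UNIV. (if pmf Q x * pmf (V x) y = 0 then 0
        else pmf Q x * pmf (V x) y * ln (pmf (V x) y / ou y)) + pmf Q x * pmf (V x) y * ln (1 - bet))"
    proof -
      have "(\<Sum>x\<in>UNIV. \<Sum>y\<in>UNIV. pmf Q x * pmf (V x) y * ln (1 - bet)) = ln (1 - bet)"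
        by (simp add: sum_pmf_eq_1 flip: sum_distrib_left sum_distrib_right)
      then show ?thesis unfolding mutual_info_nats ou_def by (simp add: sum.distrib)
    qed
    also have "\<dots> \<le> (\<Sum>x\<in>UNIV. \<Sum>y\<in>UNIV. pmf (V x) y * (- pmf Q x * ln (pmf Q x / a y x)))"
    proof (intro sum_mono)
      fix x y
      let ?q = "pmf Q x" and ?w = "pmf (V x) y"
      show "(if ?q * ?w = 0 then 0 else ?q * ?w * ln (?w / ou y)) + ?q * ?w * ln (1 - bet)
         \<le> ?w * (- ?q * ln (?q / a y x))"
      proof (cases "?q * ?w = 0")
        case False
        then have pos: "0 < ?q" "0 < ?w" by (simp_all add: less_le)
        have opos: "0 < ou y"
          using pmf_times_le_pmf_bind[of Q x V y] mult_pos_pos[OF pos] unfolding ou_def by linarith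
        have r: "0 < (1 - bet) * (?w / ou y)" using bet pos opos by simp
        have "(1 - bet) * (?q * ?w / ou y) \<le> a y x"
          using opos bet by (simp add: a_def p_def)
        then have le: "(1 - bet) * (?w / ou y) \<le> a y x / ?q" using pos by (simp add: field_simps)
        have "ln ((1 - bet) * (?w / ou y)) = ln (1 - bet) + ln (?w / ou y)"
          using bet pos opos by (subst ln_mult) auto
        then have "ln (1 - bet) + ln (?w / ou y) \<le> ln (a y x / ?q)"
          using le r ln_le_cancel_iff[of "(1 - bet) * (?w / ou y)" "a y x / ?q"] by linarith
        also have "\<dots> = - ln (?q / a y x)"
          using le r pos ln_inverse[of "?q / a y x"] by (simp add: zero_less_divide_iff)
        finally have "?q * ?w * (ln (1 - bet) + ln (?w / ou y)) \<le> ?q * ?w * (- ln (?q / a y x))"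
          using pos by (intro mult_left_mono) auto
        then show ?thesis using False by (simp add: algebra_simps)
      qed auto
    qed
    finally show "ln 2 * mutual_info Q V + ln (1 - bet) \<le>
      (\<Sum>x\<in>UNIV. \<Sum>y\<in>UNIV. pmf (V x) y * (- pmf Q x * ln (pmf Q x / a y x)))" .
  qed
qed

lemma ln_two_ge_half: "1/2 \<le> ln (2::real)"
  using ln_le_minus_one[of "1/2 :: real"] by (simp add: ln_div)

lemma ln_one_minus_ge:
  fixes x :: real
  assumes "0 \<le> x" "x \<le> 1/2"
  shows "- 2 * x \<le> ln (1 - x)"
proof -
  have "ln (1 / (1 - x)) \<le> 1 / (1 - x) - 1" using assms by (intro ln_le_minus_one) auto
  also have "\<dots> = x / (1 - x)" using assms by (simp add: field_simps)
  also have "\<dots> \<le> x / (1/2)" using assms by (intro divide_left_mono) auto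
  finally show ?thesis using assms by (simp add: ln_div)
qed

section \<open>Achieved rate\<close>

context scheme
begin

text \<open>\<open>T\<close> collects the losses in nats: pilots and smoothing through
  \<open>kap\<close>, smoothing of the comparator, the tail loss \<open>S\<close>, one unfinished
  block, and the overhead of each block in threshold and overshoot. The threshold makes the error
  bound exactly \<open>e\<close>; a union bound adds the event of small gain.\<close>

lemma rate_tail:
  fixes W :: "nat \<Rightarrow> 'x::finite \<Rightarrow> 'y::finite pmf" and rho e del :: real and n :: nat
  defines "d \<equiv> real CARD('x)"
  defines "A \<equiv> d / bet" and "D \<equiv> d / lam"
  defines "B \<equiv> 2 * ln A + 5"
  defines "S \<equiv> (1 + real CARD('y)) * ln d / eta +
      (rho * (2 * d * D * B\<^sup>2) + 6 * eta * d * D * A) * real n + ln (1 / del) / rho"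
  defines "T \<equiv> (lam + bet) * d * real n + 2 * bet * real n + S + real K +
      (2 * d * (real n / real K) + 1) * (ln ((real n + 1) / e) + ln A)"
  assumes n: "0 < n" and K: "0 < K" and e: "0 < e" "e \<le> 1" and thr: "thr = 2 ^ K * ((real n + 1) / e)"
    and small: "eta * D * (6 * A) \<le> 1" and rho: "0 < rho" "rho * D * B \<le> 1" and del: "0 < del" "del \<le> 1"
  shows "measure_pmf.prob (traj W b n) {t. err b t} \<le> e" (is ?error)
    and "1 - (e + del) \<le> measure_pmf.prob (traj W b n)
      {t. capacity (avg_channel n W) - (2 * T + 1) / real n \<le> real (length (decoded t)) * real K / real n}" (is ?rate)
proof -
  let ?V = "avg_channel n W"
  define lM where "lM = ln ((real n + 1) / e)"
  have M1: "1 \<le> (real n + 1) / e" using e n by (simp add: field_simps)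
  then have lM0: "0 \<le> lM" by (simp add: lM_def)
  have "(2::real) ^ 1 \<le> 2 ^ K" using K by (intro power_increasing) auto
  then have "2 * 1 \<le> thr" unfolding thr using M1 by (intro mult_mono) auto
  then have thr1: "1 < thr" by simp
  have lnthr: "ln thr = real K * ln 2 + lM"
    unfolding thr lM_def using M1 by (subst ln_mult) (auto simp: ln_realpow)
  have A1: "1 \<le> A" unfolding A_def d_def by (rule card_div_bet_ge)
  then have lA0: "0 \<le> ln A" by simp
  have "(real n + 1) * 2 ^ K / thr = e" unfolding thr using e by simp
  then show err: ?error using error_prob[of W b n] thr1 by simp
  \<comment> \<open>An input law within \<open>1 / n\<close> of the supremum is enough; the deficit
    becomes the \<open>+ 1\<close> in \<open>2 * T + 1\<close>.\<close>
  obtain Q where Q: "capacity ?V - 1 / real n < mutual_info Q ?V"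
  proof -
    have "\<exists>Q. capacity ?V - 1 / real n < mutual_info Q ?V"
    proof (rule ccontr)
      assume "\<nexists>Q. capacity ?V - 1 / real n < mutual_info Q ?V"
      then have "capacity ?V \<le> capacity ?V - 1 / real n"
        unfolding capacity_def by (intro cSUP_least) (auto simp: not_less)
      then show False using n by simp
    qed
    then show ?thesis using that by blast
  qed
  define I where "I = ln 2 * mutual_info Q ?V"
  have Id: "I \<le> d" unfolding I_def d_def by (rule mutual_info_le_card)
  obtain a :: "'y \<Rightarrow> 'x \<Rightarrow> real" where a: "\<And>y x. bet / real CARD('x) \<le> a y x" "\<And>y. (\<Sum>x\<in>UNIV. a y x) = 1"
    and aI: "I + ln (1 - bet) \<le>
      (\<Sum>x\<in>UNIV. \<Sum>y\<in>UNIV. pmf (?V x) y * (- pmf Q x * ln (pmf Q x / a y x)))"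
    unfolding I_def by (rule smoothed_posterior[OF bet, of Q ?V]) blast
  define F where "F = (\<Sum>i<n. \<Sum>x\<in>UNIV. \<Sum>y\<in>UNIV. pmf (W i x) y * (- pmf Q x * ln (pmf Q x / a y x)))"
  define kap where "kap = (1 - bet) * (1 - lam)"
  have kap: "0 \<le> kap" "kap \<le> 1" "1 - kap \<le> lam + bet" "0 \<le> 1 - kap"
  proof -
    show "0 \<le> kap" "kap \<le> 1" unfolding kap_def using bet lam by (auto intro!: mult_nonneg_nonneg mult_le_one)
    then show "0 \<le> 1 - kap" by simp
    have "0 \<le> bet * lam" using bet lam by simp
    then show "1 - kap \<le> lam + bet" by (simp add: kap_def algebra_simps)
  qed
  have kF: "real n * I - (lam + bet) * d * real n - 2 * bet * real n \<le> kap * F"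
  proof -
    \<comment> \<open>Linearity in the channel: the individual \<open>W i\<close> enter only through
      their average.\<close>
    have "F = real n * (\<Sum>x\<in>UNIV. \<Sum>y\<in>UNIV. pmf (?V x) y * (- pmf Q x * ln (pmf Q x / a y x)))"
      unfolding F_def by (rule sum_avg_channel[OF n])
    then have "real n * (I + ln (1 - bet)) \<le> F" using aI by (simp add: mult_left_mono)
    moreover have "real n * (I - 2 * bet) \<le> real n * (I + ln (1 - bet))"
      using ln_one_minus_ge[of bet] bet by (intro mult_left_mono) auto
    ultimately have "kap * (real n * (I - 2 * bet)) \<le> kap * F"
      using kap by (intro mult_left_mono) auto
    moreover have "(1 - kap) * I \<le> (lam + bet) * d"
    proof -
      have "(1 - kap) * I \<le> (1 - kap) * d" using kap Id by (intro mult_left_mono) auto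
      also have "\<dots> \<le> (lam + bet) * d" using kap by (intro mult_right_mono) (auto simp: d_def)
      finally show ?thesis .
    qed
    then have "real n * ((1 - kap) * I) \<le> real n * ((lam + bet) * d)" by (intro mult_left_mono) auto
    moreover have "kap * (real n * (2 * bet)) \<le> 1 * (real n * (2 * bet))"
      using kap bet by (intro mult_right_mono) auto
    ultimately show ?thesis by (simp add: algebra_simps)
  qed
  let ?G = "{t. gain b t < kap * F - S}"
  have G: "measure_pmf.prob (traj W b n) ?G \<le> del"
  proof -
    have sum_pmf_Q: "(\<Sum>x\<in>UNIV. pmf Q x) = 1" by (simp add: sum_pmf_eq_1)
    have S_eq: "(1 + real CARD('y)) * ln (real CARD('x)) / eta +
        real n * (rho\<^sup>2 * (2 * real CARD('x) * (real CARD('x) / lam) * (2 * ln (real CARD('x) / bet) + 5)\<^sup>2) +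
          rho * (6 * eta * real CARD('x) * (real CARD('x) / lam) * (real CARD('x) / bet))) / rho +
        ln (1 / del) / rho = S"
    proof -
      have eq: "real n * (rho\<^sup>2 * u + rho * w) / rho = (rho * u + w) * real n" for u w :: real
        using rho by (simp add: power2_eq_square field_simps)
      show ?thesis unfolding S_def B_def A_def D_def d_def eq ..
    qed
    show ?thesis
      using gain_tail[OF small[unfolded A_def D_def d_def] rho(1) rho(2)[unfolded B_def A_def D_def d_def]
          pmf_nonneg sum_pmf_Q a del(1), of W b n]
      by (simp only: S_eq F_def kap_def)
  qed
  have T_nonneg: "0 \<le> T"
  proof -
    have d1: "1 \<le> d" unfolding d_def using zero_less_card_finite[where 'a='x] by linarith
    have "0 \<le> D" unfolding D_def using d1 lam by simp
    moreover have "0 \<le> ln (1 / del)" using del by (intro ln_ge_zero) simp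
    ultimately have "0 \<le> S"
      unfolding S_def using d1 eta rho A1 del
      by (intro add_nonneg_nonneg mult_nonneg_nonneg divide_nonneg_nonneg) auto
    then show ?thesis
      unfolding T_def lM_def[symmetric] using d1 lam bet lM0 lA0
      by (intro add_nonneg_nonneg mult_nonneg_nonneg divide_nonneg_nonneg) auto
  qed
  let ?R = "{t. capacity ?V - (2 * T + 1) / real n \<le> real (length (decoded t)) * real K / real n}"
  have rate: "t \<in> ?R" if "\<not> err b t" "t \<notin> ?G"
    for t :: "(('x option \<times> (('x \<times> 'y) option list \<times> bool list \<Rightarrow> 'x)) \<times> 'y) list"
  proof -
    define j where "j = real (length (decoded t))"
    have T0: "real n * I - j * real K * ln 2 \<le> T"
    \<comment> \<open>Either the decoded bits already match \<open>n * I\<close>, or they are few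
      enough to bound the number of blocks and thereby the total overhead.\<close>
    proof (cases "real n * I \<le> j * real K * ln 2")
      case True
      then show ?thesis using T_nonneg by linarith
    next
      case False
      then have "j * real K * ln 2 < real n * d"
        using mult_left_mono[OF Id, of "real n"] by linarith
      moreover have "j * real K * (1/2) \<le> j * real K * ln 2"
        using ln_two_ge_half by (intro mult_left_mono) (auto simp: j_def)
      ultimately have "j * real K \<le> 2 * (real n * d)" by linarith
      then have j: "j \<le> 2 * d * (real n / real K)" using K by (simp add: field_simps)
      have "kap * F - S \<le> (j + 1) * (ln thr + ln A)"
        using gain_le[OF thr1 that(1)] that(2) unfolding j_def A_def d_def by simp
      also have "\<dots> = j * real K * ln 2 + real K * ln 2 + (j + 1) * (lM + ln A)"
        by (simp add: lnthr algebra_simps)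
      also have "real K * ln 2 \<le> real K * 1" using ln_le_minus_one[of "2::real"] by (intro mult_left_mono) auto
      also have "(j + 1) * (lM + ln A) \<le> (2 * d * (real n / real K) + 1) * (lM + ln A)"
        using j lM0 lA0 by (intro mult_right_mono) auto
      finally show ?thesis using kF unfolding T_def lM_def[symmetric] by linarith
    qed
    \<comment> \<open>From nats to bits: dividing by \<open>ln 2 \<ge> 1/2\<close> at most doubles
      the loss.\<close>
    have "T * (1/2) \<le> T * ln 2" using ln_two_ge_half T_nonneg by (intro mult_left_mono) auto
    then have "ln 2 * (real n * mutual_info Q ?V) \<le> ln 2 * (j * real K + 2 * T)"
      using T0 unfolding I_def by (simp add: algebra_simps)
    then have "real n * mutual_info Q ?V \<le> j * real K + 2 * T" by simp
    moreover have "real n * (capacity ?V - 1 / real n) \<le> real n * mutual_info Q ?V"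
      using Q by (intro mult_left_mono) auto
    ultimately have "real n * capacity ?V - (2 * T + 1) \<le> j * real K"
      using n by (simp add: right_diff_distrib)
    then have "(real n * capacity ?V - (2 * T + 1)) / real n \<le> j * real K / real n"
      by (intro divide_right_mono) auto
    then show ?thesis using n by (simp add: diff_divide_distrib j_def)
  qed
  have "1 = measure_pmf.prob (traj W b n) ({t. err b t} \<union> ?G \<union> ?R)"
  proof -
    have "{t. err b t} \<union> ?G \<union> ?R =
        (UNIV :: (('x option \<times> (('x \<times> 'y) option list \<times> bool list \<Rightarrow> 'x)) \<times> 'y) list set)"
      using rate by blast
    then show ?thesis by simp
  qed
  also have "\<dots> \<le> measure_pmf.prob (traj W b n) ({t. err b t} \<union> ?G) + measure_pmf.prob (traj W b n) ?R"
    by (intro measure_Un_le) auto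
  also have "measure_pmf.prob (traj W b n) ({t. err b t} \<union> ?G) \<le>
      measure_pmf.prob (traj W b n) {t. err b t} + measure_pmf.prob (traj W b n) ?G"
    by (intro measure_Un_le) auto
  finally show ?rate using err G by linarith
qed

section \<open>From decoded blocks to rate and bit estimates\<close>

lemma concat_blocks: "concat (map (block b) [0..<k]) = map b [0..<k * K]"
proof (induction k)
  case (Suc k)
  have "[0..<Suc k * K] = [0..<k * K] @ [k * K..<k * K + K]"
    using upt_add_eq_append[of 0 "k * K" K] by (simp add: add.commute[of K])
  then show ?case using Suc by (simp add: block_def)
qed simp

text \<open>The rate times \<open>n\<close> is exactly the integer number of decoded bits, so the
  ceiling requests no further bit.\<close>

lemma decoding_error_imp_err:
  fixes t :: "(('x::finite option \<times> (('x \<times> 'y::finite) option list \<times> bool list \<Rightarrow> 'x)) \<times> 'y) list"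
  assumes n: "0 < n"
    and "decoding_error n (\<lambda>_ _. real (length (decoded t)) * real K / real n) (\<lambda>_ _ j. concat (decoded t) ! j) b s ys"
  shows "err b t"
proof (rule ccontr)
  assume no_err: "\<not> err b t"
  have "decoded t = map (block b) [0..<length (decoded t)]"
    using no_err unfolding err_def by (intro nth_equalityI) auto
  then have eq: "concat (decoded t) = map b [0..<length (decoded t) * K]"
    using concat_blocks by metis
  have "nat \<lceil>real n * (real (length (decoded t)) * real K / real n)\<rceil> = length (decoded t) * K"
  proof -
    have "real n * (real (length (decoded t)) * real K / real n) = real (length (decoded t) * K)"
      using n by simp
    then show ?thesis by (simp only: ceiling_of_nat nat_int)
  qed
  then show False using assms(2) unfolding decoding_error_def eq by auto
qed

text \<open>The scheme never refers to the channel, so a single system is obtained before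
  \<open>W\<close> is quantified; bounds along \<open>traj\<close> for each message transfer to
  it.\<close>

lemma system_of_scheme:
  fixes n :: nat
  assumes n: "0 < n"
  shows "\<exists>MSr (f :: nat \<Rightarrow> (nat \<Rightarrow> bool) \<Rightarrow> 'y::finite list \<Rightarrow> real \<Rightarrow> 'x::finite) g dec. ra_system n MSr f g dec \<and>
    (\<forall>W e. (\<forall>b. measure_pmf.prob (traj W b n) {t. err b t} \<le> e) \<longrightarrow>
       sys_prob n W MSr f (decoding_error n g dec) \<le> e) \<and>
    (\<forall>W c e. (\<forall>b. e \<le> measure_pmf.prob (traj W b n) {t. c \<le> real (length (decoded t)) * real K / real n}) \<longrightarrow>
       e \<le> sys_prob n W MSr f (\<lambda>b s ys. c \<le> g ys s))"
proof -
  define G where "G ys ss = real (length (decoded (zip ss ys))) * real K / real n"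
    for ys :: "'y list" and ss :: "('x option \<times> (('x \<times> 'y) option list \<times> bool list \<Rightarrow> 'x)) list"
  define dec0 where "dec0 ys ss j = concat (decoded (zip ss ys)) ! j"
    for ys :: "'y list" and ss :: "('x option \<times> (('x \<times> 'y) option list \<times> bool list \<Rightarrow> 'x)) list" and j
  define J where "J W b = bind_pmf (rnd_list n)
     (\<lambda>ss. map_pmf (Pair ss) (outputs (\<lambda>i ys. W i (encoder i b ys ss)) n))"
    for W :: "nat \<Rightarrow> 'x \<Rightarrow> 'y pmf" and b
  have J: "measure_pmf.prob (J W b) {(ss, ys). P (zip ss ys)} = measure_pmf.prob (traj W b n) {t. P t}" for W b P
  proof -
    have "traj W b n = map_pmf (\<lambda>(ss, ys). zip ss ys) (J W b)"
      unfolding traj_eq_bind_rnd_list J_def by (simp add: map_bind_pmf pmf.map_comp o_def)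
    then show ?thesis by (simp add: vimage_def case_prod_unfold)
  qed
  have G0: "0 \<le> G ys ss" for ys ss by (simp add: G_def)
  have "\<exists>MSr (f :: nat \<Rightarrow> (nat \<Rightarrow> bool) \<Rightarrow> 'y list \<Rightarrow> real \<Rightarrow> 'x) g dec. ra_system n MSr f g dec \<and>
    (\<forall>W e. (\<forall>b. measure_pmf.prob (J W b)
        {(s, ys). decoding_error n (\<lambda>ys _. G ys s) (\<lambda>ys _. dec0 ys s) b 0 ys} \<le> e) \<longrightarrow>
       sys_prob n W MSr f (decoding_error n g dec) \<le> e) \<and>
    (\<forall>W c e. (\<forall>b. e \<le> measure_pmf.prob (J W b) {(s, ys). c \<le> G ys s}) \<longrightarrow>
       e \<le> sys_prob n W MSr f (\<lambda>b s ys. c \<le> g ys s))"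
    unfolding J_def
    by (rule ra_system_of_finite_randomness[where L = "n * K", OF finite_set_rnd_list G0],
        rule encoder_finite_bits[where n = n], assumption, simp)
  then obtain MSr and f :: "nat \<Rightarrow> (nat \<Rightarrow> bool) \<Rightarrow> 'y list \<Rightarrow> real \<Rightarrow> 'x" and g dec where
    ra: "ra_system n MSr f g dec"
    and err: "\<forall>W e. (\<forall>b. measure_pmf.prob (J W b)
        {(s, ys). decoding_error n (\<lambda>ys _. G ys s) (\<lambda>ys _. dec0 ys s) b 0 ys} \<le> e) \<longrightarrow>
       sys_prob n W MSr f (decoding_error n g dec) \<le> e"
    and rate: "\<forall>W c e. (\<forall>b. e \<le> measure_pmf.prob (J W b) {(s, ys). c \<le> G ys s}) \<longrightarrow>
       e \<le> sys_prob n W MSr f (\<lambda>b s ys. c \<le> g ys s)"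
    by (elim exE conjE)
  show ?thesis
  proof (intro exI conjI allI impI)
    show "ra_system n MSr f g dec" by (rule ra)
  next
    fix W :: "nat \<Rightarrow> 'x \<Rightarrow> 'y pmf" and e :: real
    assume e: "\<forall>b. measure_pmf.prob (traj W b n) {t. err b t} \<le> e"
    show "sys_prob n W MSr f (decoding_error n g dec) \<le> e"
    proof (rule err[rule_format])
      fix b
      have "measure_pmf.prob (J W b) {(s, ys). decoding_error n (\<lambda>ys _. G ys s) (\<lambda>ys _. dec0 ys s) b 0 ys} \<le>
        measure_pmf.prob (J W b) {(s, ys). err b (zip s ys)}"
      proof (intro measure_pmf.finite_measure_mono subsetI; clarify?)
        fix s ys assume "decoding_error n (\<lambda>ys _. G ys s) (\<lambda>ys _. dec0 ys s) b 0 ys"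
        then have "decoding_error n (\<lambda>_ _. real (length (decoded (zip s ys))) * real K / real n)
            (\<lambda>_ _ j. concat (decoded (zip s ys)) ! j) b 0 ys"
          by (simp add: decoding_error_def G_def dec0_def)
        then show "err b (zip s ys)" by (rule decoding_error_imp_err[OF n])
      qed simp
      also have "\<dots> = measure_pmf.prob (traj W b n) {t. err b t}" by (rule J)
      finally show "measure_pmf.prob (J W b) {(s, ys). decoding_error n (\<lambda>ys _. G ys s) (\<lambda>ys _. dec0 ys s) b 0 ys} \<le> e"
        using spec[OF e, of b] by linarith
    qed
  next
    fix W :: "nat \<Rightarrow> 'x \<Rightarrow> 'y pmf" and c e :: real
    assume e: "\<forall>b. e \<le> measure_pmf.prob (traj W b n) {t. c \<le> real (length (decoded t)) * real K / real n}"
    show "e \<le> sys_prob n W MSr f (\<lambda>b s ys. c \<le> g ys s)"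
      by (rule rate[rule_format])
        (unfold G_def J[of W _ "\<lambda>t. c \<le> real (length (decoded t)) * real K / real n"], rule e[rule_format])
  qed
qed

end

section \<open>Choice of parameters and conclusion\<close>

theorem theorem3:
  fixes \<epsilon> \<delta> :: real
  assumes "\<epsilon> > 0" and "\<delta> > 0"
  shows "\<exists>(N::nat) (c\<^sub>\<Delta>::real). \<forall>n\<ge>N.
    \<exists>(MSr :: real measure) (f :: nat \<Rightarrow> (nat \<Rightarrow> bool) \<Rightarrow> 'y::finite list \<Rightarrow> real \<Rightarrow> 'x::finite)
      g dec.
      ra_system n MSr f g dec \<and>
      (\<forall>W :: nat \<Rightarrow> 'x \<Rightarrow> 'y pmf.
         sys_prob n W MSr f (decoding_error n g dec) \<le> \<epsilon> \<and>
         sys_prob n W MSr f (\<lambda>b s ys. g ys s \<ge> capacity (avg_channel n W)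
               - c\<^sub>\<Delta> * ((ln (real n))\<^sup>2 / real n) powr (1/4))
           \<ge> 1 - \<delta>)"
proof -
  define d where "d = real CARD('x)"
  \<comment> \<open>The cap at \<open>1\<close> meets the hypotheses of \<open>rate_tail\<close>;
    the two halves of \<open>\<delta>\<close> pay for a decoding error and for too small a
    gain.\<close>
  define e where "e = min 1 (min \<epsilon> (\<delta> / 2))"
  define del where "del = min 1 (\<delta> / 2)"
  have d: "0 < d" by (simp add: d_def)
  have e: "0 < e" "e \<le> 1" "e \<le> \<epsilon>" "e \<le> \<delta> / 2" using assms by (auto simp: e_def)
  have del: "0 < del" "del \<le> 1" "del \<le> \<delta> / 2" using assms by (auto simp: del_def)
  note ev = loss_eventually_small[OF d e(1), of "(1 + real CARD('y)) * ln d" "ln (1 / del)"]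
    params_eventually[OF d] eventually_gt_at_top[of 1]
  have "eventually (\<lambda>x::real. (2 * (2 * d * x powr (-1/4) * x + 2 * x powr (-1/4) * x +
      ((1 + real CARD('y)) * ln d / x powr (-3/4) +
       (x powr (-5/8) * (2 * d * (d / x powr (-1/4)) * (2 * ln (d / x powr (-1/4)) + 5)\<^sup>2) +
        6 * x powr (-3/4) * d * (d / x powr (-1/4)) * (d / x powr (-1/4))) * x + ln (1 / del) / x powr (-5/8)) +
      (sqrt x + 1) + (2 * d * sqrt x + 1) * (ln ((x + 1) / e) + ln (d / x powr (-1/4)))) + 1) / x
        \<le> ((ln x)\<^sup>2 / x) powr (1/4) \<and>
      x powr (-1/4) \<le> 1/2 \<and>
      x powr (-3/4) * (d / x powr (-1/4)) * (6 * (d / x powr (-1/4))) \<le> 1 \<and>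
      x powr (-5/8) * (d / x powr (-1/4)) * (2 * ln (d / x powr (-1/4)) + 5) \<le> 1 \<and> 1 < x) at_top"
    using ev by eventually_elim auto
  then obtain X where X: "\<And>x. X \<le> x \<Longrightarrow> (2 * (2 * d * x powr (-1/4) * x + 2 * x powr (-1/4) * x +
      ((1 + real CARD('y)) * ln d / x powr (-3/4) +
       (x powr (-5/8) * (2 * d * (d / x powr (-1/4)) * (2 * ln (d / x powr (-1/4)) + 5)\<^sup>2) +
        6 * x powr (-3/4) * d * (d / x powr (-1/4)) * (d / x powr (-1/4))) * x + ln (1 / del) / x powr (-5/8)) +
      (sqrt x + 1) + (2 * d * sqrt x + 1) * (ln ((x + 1) / e) + ln (d / x powr (-1/4)))) + 1) / x
        \<le> ((ln x)\<^sup>2 / x) powr (1/4) \<and>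
      x powr (-1/4) \<le> 1/2 \<and>
      x powr (-3/4) * (d / x powr (-1/4)) * (6 * (d / x powr (-1/4))) \<le> 1 \<and>
      x powr (-5/8) * (d / x powr (-1/4)) * (2 * ln (d / x powr (-1/4)) + 5) \<le> 1 \<and> 1 < x"
    unfolding eventually_at_top_linorder by blast
  show ?thesis
  proof (intro exI[of _ "nat \<lceil>X\<rceil>"] exI[of _ 1] allI impI)
    fix n assume "nat \<lceil>X\<rceil> \<le> n"
    then have "X \<le> real n" by linarith
    note Xn = X[OF this]
    \<comment> \<open>The same value serves as pilot probability and as smoothing. The losses
      \<open>lam\<close>, \<open>1 / (eta * n)\<close> and \<open>eta / lam\<^sup>2\<close> per use
      are then all of order \<open>n powr (-1/4)\<close>.\<close>
    define lam where "lam = real n powr (-1/4)"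
    define eta where "eta = real n powr (-3/4)"
    \<comment> \<open>Balances \<open>rho / lam\<close> against \<open>1 / (rho * n)\<close>: up to
      logarithms both are of order \<open>n powr (-3/8)\<close>, which is negligible.\<close>
    define rho where "rho = real n powr (-5/8)"
    \<comment> \<open>Balances the unfinished block, of order \<open>K\<close>, against the overhead
      of about \<open>n / K\<close> blocks.\<close>
    define K where "K = nat \<lceil>sqrt (real n)\<rceil>"
    define thr where "thr = 2 ^ K * ((real n + 1) / e)"
    define S where "S = (1 + real CARD('y)) * ln d / eta +
      (rho * (2 * d * (d / lam) * (2 * ln (d / lam) + 5)\<^sup>2) + 6 * eta * d * (d / lam) * (d / lam)) * real n +
      ln (1 / del) / rho"
    define T where "T = (lam + lam) * d * real n + 2 * lam * real n + S + real K +
      (2 * d * (real n / real K) + 1) * (ln ((real n + 1) / e) + ln (d / lam))"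
    have loss: "(2 * (2 * d * lam * real n + 2 * lam * real n + S + (sqrt (real n) + 1) +
        (2 * d * sqrt (real n) + 1) * (ln ((real n + 1) / e) + ln (d / lam))) + 1) / real n
        \<le> ((ln (real n))\<^sup>2 / real n) powr (1/4)"
      and lam_half: "lam \<le> 1/2"
      and small: "eta * (d / lam) * (6 * (d / lam)) \<le> 1"
      and rho1: "rho * (d / lam) * (2 * ln (d / lam) + 5) \<le> 1"
      and n1: "1 < real n"
      using Xn unfolding lam_def eta_def rho_def S_def by auto
    have n: "0 < n" using n1 by simp
    have pos: "0 < lam" "0 < eta" "0 < rho" using n by (auto simp: lam_def eta_def rho_def)
    interpret scheme lam lam eta thr K
      using pos lam_half by unfold_locales auto
    have sn: "0 < sqrt (real n)" using n by simp
    have K: "sqrt (real n) \<le> real K" "real K \<le> sqrt (real n) + 1"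
    proof -
      have "0 \<le> \<lceil>sqrt (real n)\<rceil>" using sn by linarith
      then have "real K = of_int \<lceil>sqrt (real n)\<rceil>" by (simp add: K_def)
      then show "sqrt (real n) \<le> real K" "real K \<le> sqrt (real n) + 1" by linarith+
    qed
    have "0 < real K" using K(1) sn by linarith
    then have K0: "0 < K" by simp
    have T: "(2 * T + 1) / real n \<le> ((ln (real n))\<^sup>2 / real n) powr (1/4)"
    proof -
      have "real n / real K \<le> real n / sqrt (real n)"
        using K(1) sn K0 by (intro divide_left_mono) auto
      then have nK: "real n / real K \<le> sqrt (real n)" by (simp add: real_div_sqrt)
      have "1 \<le> (real n + 1) / e" using e n by (simp add: field_simps)
      then have "0 \<le> ln ((real n + 1) / e)" by simp
      moreover have "0 \<le> ln (d / lam)"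
        using card_div_bet_ge[where 'x='x] unfolding d_def by simp
      ultimately have "(2 * d * (real n / real K) + 1) * (ln ((real n + 1) / e) + ln (d / lam)) \<le>
         (2 * d * sqrt (real n) + 1) * (ln ((real n + 1) / e) + ln (d / lam))"
        using nK d by (intro mult_right_mono add_mono mult_left_mono) auto
      then have "T \<le> 2 * d * lam * real n + 2 * lam * real n + S + (sqrt (real n) + 1) +
        (2 * d * sqrt (real n) + 1) * (ln ((real n + 1) / e) + ln (d / lam))"
        unfolding T_def using K(2) by (simp add: algebra_simps)
      then have "(2 * T + 1) / real n \<le> (2 * (2 * d * lam * real n + 2 * lam * real n + S + (sqrt (real n) + 1) +
        (2 * d * sqrt (real n) + 1) * (ln ((real n + 1) / e) + ln (d / lam))) + 1) / real n"
        by (intro divide_right_mono) auto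
      then show ?thesis using loss by linarith
    qed
    note tail = rate_tail[where rho = rho and e = e and del = del and n = n and 'x = 'x and 'y = 'y,
        folded d_def, OF n K0 e(1,2) thr_def small pos(3) rho1 del(1,2), folded S_def, folded T_def]
    obtain MSr and f :: "nat \<Rightarrow> (nat \<Rightarrow> bool) \<Rightarrow> 'y list \<Rightarrow> real \<Rightarrow> 'x" and g dec where
      sys: "ra_system n MSr f g dec"
      "\<forall>W e. (\<forall>b. measure_pmf.prob (traj W b n) {t. err b t} \<le> e) \<longrightarrow>
       sys_prob n W MSr f (decoding_error n g dec) \<le> e"
      "\<forall>W c e. (\<forall>b. e \<le> measure_pmf.prob (traj W b n) {t. c \<le> real (length (decoded t)) * real K / real n}) \<longrightarrow>
       e \<le> sys_prob n W MSr f (\<lambda>b s ys. c \<le> g ys s)"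
      using system_of_scheme[OF n] by (elim exE conjE)
    have "sys_prob n W MSr f (decoding_error n g dec) \<le> \<epsilon>" for W
      by (rule sys(2)[rule_format], rule order_trans[OF tail(1) e(3)])
    moreover have "1 - \<delta> \<le> sys_prob n W MSr f (\<lambda>b s ys. capacity (avg_channel n W)
               - 1 * ((ln (real n))\<^sup>2 / real n) powr (1/4) \<le> g ys s)" for W
    proof (rule sys(3)[rule_format])
      fix b
      have "1 - \<delta> \<le> 1 - (e + del)" using e del by linarith
      also have "\<dots> \<le> measure_pmf.prob (traj W b n)
        {t. capacity (avg_channel n W) - (2 * T + 1) / real n \<le> real (length (decoded t)) * real K / real n}"
        by (rule tail(2))
      also have "\<dots> \<le> measure_pmf.prob (traj W b n)
        {t. capacity (avg_channel n W) - 1 * ((ln (real n))\<^sup>2 / real n) powr (1/4) \<le> real (length (decoded t)) * real K / real n}"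
        using T by (intro measure_pmf.finite_measure_mono) auto
      finally show "1 - \<delta> \<le> measure_pmf.prob (traj W b n)
        {t. capacity (avg_channel n W) - 1 * ((ln (real n))\<^sup>2 / real n) powr (1/4) \<le> real (length (decoded t)) * real K / real n}" .
    qed
    ultimately show "\<exists>(MSr :: real measure) (f :: nat \<Rightarrow> (nat \<Rightarrow> bool) \<Rightarrow> 'y list \<Rightarrow> real \<Rightarrow> 'x) g dec.
      ra_system n MSr f g dec \<and>
      (\<forall>W :: nat \<Rightarrow> 'x \<Rightarrow> 'y pmf.
         sys_prob n W MSr f (decoding_error n g dec) \<le> \<epsilon> \<and>
         sys_prob n W MSr f (\<lambda>b s ys. g ys s \<ge> capacity (avg_channel n W)
               - 1 * ((ln (real n))\<^sup>2 / real n) powr (1/4))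
           \<ge> 1 - \<delta>)"
      using sys(1) by blast
  qed
qed

end
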